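(* Let $R$ be a commutative ring with nonzero identity and with Jacobson radical $M$. The following statements are equivalent. (1) $R$ is an $OAF$-ring. (2) Each proper $2$-generated ideal of $R$ has an $OA$-factorization. (3) $\dim(R)\leq 1$ and each proper principal ideal of $R$ has an $OA$-factorization. (4) $R$ satisfies one of the following conditions. (A) $R$ is a general $ZPI$-ring. (B) $R$ is a local domain, $M^2$ is divided and $\bigcap_{n\in\mathbb{N}} M^n=\{0\}$. (C) $R$ is local, $M^2$ is divided and $M$ is nilpotent.
   Context: All rings are commutative with nonzero identity; $\dim$ denotes Krull dimension; $\mathbb{N}$ is the set of positive integers. Local means having exactly one maximal ideal (no Noetherian assumption). An ideal $I$ of $R$ is proper if $I\neq R$, and $2$-generated if $I=xR+yR$ for some (not necessarily distinct) $x,y\in R$. A proper ideal $I$ of $R$ is an $OA$-ideal ($1$-absorbing prime ideal) if whenever $a,b,c\in R$ are nonunits with $abc\in I$, then $ab\in I$ or $c\in I$. An $OA$-factorization of a proper ideal $I$ is an expression $I=\prod_{i=1}^n J_i$ ($n\ge 1$) as a product of $OA$-ideals $J_i$. A ring is an $OAF$-ring if every proper ideal has an $OA$-factorization. A ring is a general $ZPI$-ring if every proper ideal is a finite product of prime ideals. An ideal $I$ of $R$ is divided if it is comparable under inclusion to every ideal of $R$ (equivalently, to every principal ideal of $R$). *)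

theory Defs
  imports "HOL-Algebra.Algebra" "HOL-Library.Extended_Nat"
begin

text \<open>
  All notions are meant for a commutative ring \<open>R\<close> in the sense of the locale
  \<^locale>\<open>cring\<close>; that \<open>R\<close> is not the zero ring is a separate hypothesis
  wherever it is needed.
\<close>

definition proper_ideal :: "'a set \<Rightarrow> ('a, 'b) ring_scheme \<Rightarrow> bool" where
  "proper_ideal I R \<longleftrightarrow> ideal I R \<and> I \<noteq> carrier R"

definition two_generated :: "'a set \<Rightarrow> ('a, 'b) ring_scheme \<Rightarrow> bool" where
  "two_generated I R \<longleftrightarrow>
     (\<exists>x \<in> carrier R. \<exists>y \<in> carrier R. I = (PIdl\<^bsub>R\<^esub> x) <+>\<^bsub>R\<^esub> (PIdl\<^bsub>R\<^esub> y))"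

definition nonunits :: "('a, 'b) ring_scheme \<Rightarrow> 'a set" where
  "nonunits R = carrier R - Units R"

text \<open>1-absorbing prime ideals.\<close>

definition OA_ideal :: "'a set \<Rightarrow> ('a, 'b) ring_scheme \<Rightarrow> bool" where
  "OA_ideal I R \<longleftrightarrow> proper_ideal I R \<and>
     (\<forall>a \<in> nonunits R. \<forall>b \<in> nonunits R. \<forall>c \<in> nonunits R.
        a \<otimes>\<^bsub>R\<^esub> b \<otimes>\<^bsub>R\<^esub> c \<in> I \<longrightarrow> a \<otimes>\<^bsub>R\<^esub> b \<in> I \<or> c \<in> I)"

text \<open>The unit ideal \<open>carrier R\<close> is the neutral element of ideal multiplication.\<close>

definition ideal_list_prod :: "('a, 'b) ring_scheme \<Rightarrow> 'a set list \<Rightarrow> 'a set" where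
  "ideal_list_prod R Js = foldr (ideal_prod R) Js (carrier R)"

definition has_OA_factorization :: "'a set \<Rightarrow> ('a, 'b) ring_scheme \<Rightarrow> bool" where
  "has_OA_factorization I R \<longleftrightarrow>
     (\<exists>Js. Js \<noteq> [] \<and> (\<forall>J \<in> set Js. OA_ideal J R) \<and> I = ideal_list_prod R Js)"

definition OAF_ring :: "('a, 'b) ring_scheme \<Rightarrow> bool" where
  "OAF_ring R \<longleftrightarrow> cring R \<and> (\<forall>I. proper_ideal I R \<longrightarrow> has_OA_factorization I R)"

definition general_ZPI_ring :: "('a, 'b) ring_scheme \<Rightarrow> bool" where
  "general_ZPI_ring R \<longleftrightarrow> cring R \<and>
     (\<forall>I. proper_ideal I R \<longrightarrow>
        (\<exists>Ps. Ps \<noteq> [] \<and> (\<forall>P \<in> set Ps. primeideal P R) \<and> I = ideal_list_prod R Ps))"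

text \<open>
  The supremum of the lengths \<open>n\<close> of chains \<open>P 0 \<subset> P 1 \<subset> \<dots> \<subset> P n\<close> of prime ideals.
  As a value in \<^typ>\<open>enat\<close> it is \<open>0\<close> for the zero ring, which has no prime ideals.
\<close>

definition krull_dim :: "('a, 'b) ring_scheme \<Rightarrow> enat" where
  "krull_dim R = Sup {enat n | n. \<exists>P :: nat \<Rightarrow> 'a set.
     (\<forall>i \<le> n. primeideal (P i) R) \<and> (\<forall>i < n. P i \<subset> P (Suc i))}"

text \<open>
  The intersection with \<open>carrier R\<close> only matters for the zero ring, where there are
  no maximal ideals and the bare intersection would be \<^term>\<open>UNIV\<close>.
\<close>

definition jacobson_radical :: "('a, 'b) ring_scheme \<Rightarrow> 'a set" where
  "jacobson_radical R = carrier R \<inter> \<Inter>{m. maximalideal m R}"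

text \<open>No Noetherian assumption is made.\<close>

definition local_ring :: "('a, 'b) ring_scheme \<Rightarrow> bool" where
  "local_ring R \<longleftrightarrow> cring R \<and> (\<exists>!m. maximalideal m R)"

definition divided_ideal :: "'a set \<Rightarrow> ('a, 'b) ring_scheme \<Rightarrow> bool" where
  "divided_ideal I R \<longleftrightarrow> ideal I R \<and> (\<forall>J. ideal J R \<longrightarrow> I \<subseteq> J \<or> J \<subseteq> I)"

text \<open>Powers of an ideal are powers in the multiplicative monoid of ideals.\<close>

abbreviation ideal_power :: "('a, 'b) ring_scheme \<Rightarrow> 'a set \<Rightarrow> nat \<Rightarrow> 'a set" where
  "ideal_power R I n \<equiv> I [^]\<^bsub>ideals_set R\<^esub> n"

definition nilpotent_ideal :: "'a set \<Rightarrow> ('a, 'b) ring_scheme \<Rightarrow> bool" where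
  "nilpotent_ideal I R \<longleftrightarrow> ideal I R \<and> (\<exists>n \<ge> 1. ideal_power R I n = {\<zero>\<^bsub>R\<^esub>})"

end

theory Submission
  imports Defs
begin

text \<open>
  If a 1-absorbing prime ideal \<open>J\<close> is not prime, then it contains every product of two nonunits;
  hence \<open>R\<close> is local and \<open>J\<close> contains the square of its maximal ideal.

  (2) implies (3): let \<open>P \<subset> M\<close> be primes and work locally at \<open>M\<close>, that is, up to multiplication
  by elements outside \<open>M\<close>. Factoring \<open>(a\<^sup>3, b)\<close> with \<open>a \<in> M - P\<close> shows that \<open>P\<close> vanishes whenever
  it is generated by one element \<open>b\<close>. For arbitrary \<open>P\<close>, the factorizations of the principal ideals
  \<open>(p)\<close> with \<open>p \<in> P\<close> then give first \<open>P = M P\<close> and next \<open>p \<in> M p\<close>, so \<open>P\<close> vanishes locally as well.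
  Therefore there is at most one prime strictly below \<open>M\<close>.

  (3) implies (4): only finitely many primes are nonmaximal, and they are minimal.
  If every 1-absorbing prime ideal is prime, then prime avoidance yields for each maximal ideal \<open>M\<close>
  an element \<open>x\<close> that generates \<open>M\<close> locally, so \<open>I = M (I : M)\<close> for every \<open>I \<subseteq> M\<close>; a nonmaximal
  prime \<open>P\<close> is pure and its annihilator is not contained in \<open>P\<close>, so \<open>I = P (I : P)\<close> for \<open>I \<subseteq> P\<close>.
  Splitting off such factors ends, since every ideal contained in no nonmaximal prime contains a product of
  maximal ideals. Otherwise \<open>R\<close> is local, every \<open>z \<in> M - M\<^sup>2\<close> outside the nonmaximal primes
  satisfies \<open>M\<^sup>2 \<subseteq> (z)\<close>, and this forces nonmaximal primes to be zero.

  (4) implies (1): in cases (B) and (C), an ideal \<open>I \<subseteq> M\<^sup>n\<close> not contained in \<open>M\<^sup>n\<^sup>+\<^sup>1\<close> equals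
  \<open>x\<^sup>n\<^sup>-\<^sup>1 J\<close> with \<open>x \<in> M - M\<^sup>2\<close> and an ideal \<open>J\<close> not contained in \<open>M\<^sup>2\<close>, and \<open>(x)\<close> and \<open>J\<close> both contain \<open>M\<^sup>2\<close>.
\<close>

section \<open>Ideals and their products\<close>

context cring
begin

lemma ideal_mult_left: "\<lbrakk>ideal I R; a \<in> I; x \<in> carrier R\<rbrakk> \<Longrightarrow> x \<otimes> a \<in> I"
  by (rule ideal.I_l_closed)

lemma ideal_mult_right: "\<lbrakk>ideal I R; a \<in> I; x \<in> carrier R\<rbrakk> \<Longrightarrow> a \<otimes> x \<in> I"
  by (rule ideal.I_r_closed)

lemma ideal_add: "\<lbrakk>ideal I R; a \<in> I; b \<in> I\<rbrakk> \<Longrightarrow> a \<oplus> b \<in> I"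
  by (simp add: additive_subgroup.a_closed ideal.axioms(1))

lemma ideal_zero: "ideal I R \<Longrightarrow> \<zero> \<in> I"
  by (simp add: additive_subgroup.zero_closed ideal.axioms(1))

lemma ideal_uminus: "\<lbrakk>ideal I R; a \<in> I\<rbrakk> \<Longrightarrow> \<ominus> a \<in> I"
  by (simp add: additive_subgroup.a_inv_closed ideal.axioms(1))

lemma ideal_diff: "\<lbrakk>ideal I R; a \<in> I; b \<in> I\<rbrakk> \<Longrightarrow> a \<ominus> b \<in> I"
  by (simp add: a_minus_def ideal_add ideal_uminus)

lemma ideal_carr: "\<lbrakk>ideal I R; a \<in> I\<rbrakk> \<Longrightarrow> a \<in> carrier R"
  by (rule ideal.Icarr)

lemma ideal_subset_carrier: "ideal I R \<Longrightarrow> I \<subseteq> carrier R"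
  by (rule subsetI) (rule ideal_carr)

lemma ideal_add_cancel_left:
  assumes "ideal I R" "a \<in> I" "b \<in> carrier R"
  shows "a \<oplus> b \<in> I \<longleftrightarrow> b \<in> I"
proof
  assume "a \<oplus> b \<in> I"
  moreover have "a \<in> carrier R" using assms ideal_carr by fast
  then have "b = (a \<oplus> b) \<ominus> a" using assms(3) by algebra
  ultimately show "b \<in> I" using ideal_diff[OF assms(1)] assms(2) by metis
qed (use assms ideal_add in blast)

lemma ideal_add_cancel_right:
  assumes "ideal I R" "a \<in> I" "b \<in> carrier R"
  shows "b \<oplus> a \<in> I \<longleftrightarrow> b \<in> I"
  using ideal_add_cancel_left[OF assms] assms ideal_carr a_comm by metis

lemma ideal_minusD:
  assumes "ideal I R" "a \<ominus> b \<in> I" "b \<in> I" "a \<in> carrier R"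
  shows "a \<in> I"
proof -
  have "b \<in> carrier R" using assms ideal_carr by fast
  then have "a = (a \<ominus> b) \<oplus> b" using assms(4) by algebra
  then show ?thesis using ideal_add[OF assms(1-3)] by simp
qed

lemma ideal_criterion:
  assumes "I \<subseteq> carrier R" "\<zero> \<in> I"
    and add: "\<And>a b. \<lbrakk>a \<in> I; b \<in> I\<rbrakk> \<Longrightarrow> a \<oplus> b \<in> I"
    and mult: "\<And>a x. \<lbrakk>a \<in> I; x \<in> carrier R\<rbrakk> \<Longrightarrow> x \<otimes> a \<in> I"
  shows "ideal I R"
proof (rule idealI[OF ring_axioms])
  show "subgroup I (add_monoid R)"
  proof (rule add.subgroupI)
    show "\<ominus> a \<in> I" if "a \<in> I" for a
    proof -
      have "\<ominus> a = (\<ominus> \<one>) \<otimes> a" using that assms(1) l_minus by auto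
      then show ?thesis using mult that by simp
    qed
  qed (use assms in auto)
  show "a \<otimes> x \<in> I" if "a \<in> I" "x \<in> carrier R" for a x
    using mult[OF that] m_comm assms(1) that by (metis subsetD)
qed (fact mult)

lemma PIdl_iff:
  assumes "a \<in> carrier R"
  shows "z \<in> PIdl a \<longleftrightarrow> (\<exists>r\<in>carrier R. z = a \<otimes> r)"
  using assms m_comm by (auto simp: cgenideal_def)

lemma PIdl_zero: "PIdl \<zero> = {\<zero>}"
  using zero_closed by (auto simp: PIdl_iff intro!: exI[of _ \<zero>])

lemma PIdl_ne_carrier:
  assumes "a \<in> nonunits R"
  shows "PIdl a \<noteq> carrier R"
proof
  have a: "a \<in> carrier R" using assms by (simp add: nonunits_def)
  assume "PIdl a = carrier R"
  then obtain r where "r \<in> carrier R" "\<one> = a \<otimes> r"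
    using PIdl_iff[OF a] one_closed by metis
  then have "a \<in> Units R" using a m_comm by (auto simp: Units_def)
  then show False using assms by (simp add: nonunits_def)
qed

lemma PIdl_proper:
  assumes "a \<in> nonunits R"
  shows "proper_ideal (PIdl a) R"
  using assms PIdl_ne_carrier cgenideal_ideal by (auto simp: proper_ideal_def nonunits_def)

lemma proper_ideal_subset_nonunits:
  assumes "ideal I R" "I \<noteq> carrier R"
  shows "I \<subseteq> nonunits R"
proof
  fix a assume a: "a \<in> I"
  have "a \<notin> Units R"
  proof
    assume u: "a \<in> Units R"
    then have "inv a \<otimes> a \<in> I" using ideal_mult_left[OF assms(1) a] by blast
    then have "\<one> \<in> I" using u by simp
    then show False using assms ideal.one_imp_carrier by blast
  qed
  then show "a \<in> nonunits R" using a assms(1) ideal_carr by (force simp: nonunits_def)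
qed

lemma ideal_cancel_unit:
  assumes "ideal I R" "u \<in> Units R" "x \<in> carrier R" "u \<otimes> x \<in> I"
  shows "x \<in> I"
proof -
  have "inv u \<otimes> (u \<otimes> x) \<in> I" using ideal_mult_left[OF assms(1,4)] assms(2) by simp
  moreover have "inv u \<otimes> (u \<otimes> x) = (inv u \<otimes> u) \<otimes> x"
    by (rule m_assoc[OF Units_inv_closed[OF assms(2)] Units_closed[OF assms(2)] assms(3), symmetric])
  ultimately show ?thesis using assms by simp
qed

lemma one_notin_proper_ideal: "\<lbrakk>ideal I R; I \<noteq> carrier R\<rbrakk> \<Longrightarrow> \<one> \<notin> I"
  using ideal.one_imp_carrier by blast

lemma prime_ideal_props:
  assumes "primeideal P R"
  shows "ideal P R" "P \<noteq> carrier R" "\<one> \<notin> P"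
    "\<And>a b. \<lbrakk>a \<in> carrier R; b \<in> carrier R\<rbrakk> \<Longrightarrow> a \<otimes> b \<in> P \<longleftrightarrow> a \<in> P \<or> b \<in> P"
proof -
  interpret P: primeideal P R by fact
  show i: "ideal P R" by (rule P.is_ideal)
  show "P \<noteq> carrier R" using P.I_notcarr by simp
  then show "\<one> \<notin> P" using i by (rule one_notin_proper_ideal[rotated])
  show "a \<otimes> b \<in> P \<longleftrightarrow> a \<in> P \<or> b \<in> P" if "a \<in> carrier R" "b \<in> carrier R" for a b
    using P.I_prime that ideal_mult_left[OF i] ideal_mult_right[OF i] by blast
qed

lemma ideal_colon:
  assumes "ideal I R" "B \<subseteq> carrier R"
  shows "ideal {x \<in> carrier R. \<forall>b\<in>B. x \<otimes> b \<in> I} R"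
proof (rule ideal_criterion)
  show "\<zero> \<in> {x \<in> carrier R. \<forall>b\<in>B. x \<otimes> b \<in> I}"
    using assms ideal_zero by (auto simp: subset_iff)
next
  fix a b assume "a \<in> {x \<in> carrier R. \<forall>b\<in>B. x \<otimes> b \<in> I}" "b \<in> {x \<in> carrier R. \<forall>b\<in>B. x \<otimes> b \<in> I}"
  then show "a \<oplus> b \<in> {x \<in> carrier R. \<forall>b\<in>B. x \<otimes> b \<in> I}"
    using assms ideal_add[OF assms(1)] by (auto simp: subset_iff l_distr)
next
  fix a x assume "a \<in> {x \<in> carrier R. \<forall>b\<in>B. x \<otimes> b \<in> I}" "x \<in> carrier R"
  then show "x \<otimes> a \<in> {x \<in> carrier R. \<forall>b\<in>B. x \<otimes> b \<in> I}"
    using assms ideal_mult_left[OF assms(1)] by (auto simp: subset_iff m_assoc)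
qed auto

lemma sum_ideal_iff: "z \<in> A <+>\<^bsub>R\<^esub> B \<longleftrightarrow> (\<exists>a\<in>A. \<exists>b\<in>B. z = a \<oplus> b)"
  by (auto simp: set_add_def')

lemma ideal_prod_subsetI:
  assumes "ideal K R" "\<And>i j. \<lbrakk>i \<in> I; j \<in> J\<rbrakk> \<Longrightarrow> i \<otimes> j \<in> K"
  shows "I \<cdot> J \<subseteq> K"
proof
  fix s assume "s \<in> I \<cdot> J"
  then show "s \<in> K"
    by (induct s rule: ideal_prod.induct) (use assms ideal_add in auto)
qed

lemma ideal_prod_mono:
  assumes "I \<subseteq> I'" "J \<subseteq> J'"
  shows "I \<cdot> J \<subseteq> I' \<cdot> J'"
proof
  fix s assume "s \<in> I \<cdot> J"
  then show "s \<in> I' \<cdot> J'"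
  proof (induct s rule: ideal_prod.induct)
    case (prod i j)
    then show ?case using assms by (intro ideal_prod.prod) auto
  qed (rule ideal_prod.sum)
qed

lemma ideal_prod_subset_left: "\<lbrakk>ideal I R; ideal J R\<rbrakk> \<Longrightarrow> I \<cdot> J \<subseteq> I"
  using ideal_prod_inter by blast

lemma ideal_prod_subset_right: "\<lbrakk>ideal I R; ideal J R\<rbrakk> \<Longrightarrow> I \<cdot> J \<subseteq> J"
  using ideal_prod_inter by blast

lemma carrier_prod_ideal: "ideal I R \<Longrightarrow> carrier R \<cdot> I = I"
  using ideal_prod_commute ideal_prod_one oneideal by metis

lemma ideal_prod_left_commute:
  "\<lbrakk>ideal I R; ideal J R; ideal K R\<rbrakk> \<Longrightarrow> I \<cdot> (J \<cdot> K) = J \<cdot> (I \<cdot> K)"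
  using ideal_prod_assoc ideal_prod_commute by metis

text \<open>The multiples of \<open>x\<close> by elements of \<open>I\<close> are already closed
  under addition, so the finite sums in the product collapse to one term. The Nakayama arguments
  below rest on this form.\<close>

lemma prod_PIdl_iff:
  assumes "ideal I R" "x \<in> carrier R"
  shows "z \<in> I \<cdot> (PIdl x) \<longleftrightarrow> (\<exists>a\<in>I. z = a \<otimes> x)"
proof -
  have xI: "ideal (PIdl x) R" by (rule cgenideal_ideal[OF assms(2)])
  have id: "ideal {z. \<exists>a\<in>I. z = a \<otimes> x} R"
  proof (rule ideal_criterion)
    show "{z. \<exists>a\<in>I. z = a \<otimes> x} \<subseteq> carrier R" using assms(2) ideal_carr[OF assms(1)] by auto
    show "\<zero> \<in> {z. \<exists>a\<in>I. z = a \<otimes> x}" using assms ideal_zero by (auto intro!: bexI[of _ \<zero>])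
    fix a b assume "a \<in> {z. \<exists>a\<in>I. z = a \<otimes> x}" "b \<in> {z. \<exists>a\<in>I. z = a \<otimes> x}"
    then obtain a' b' where "a' \<in> I" "b' \<in> I" "a = a' \<otimes> x" "b = b' \<otimes> x" by auto
    then show "a \<oplus> b \<in> {z. \<exists>a\<in>I. z = a \<otimes> x}"
      using assms ideal_carr[OF assms(1)] ideal_add l_distr by (auto intro!: bexI[of _ "a' \<oplus> b'"])
  next
    fix a r assume "a \<in> {z. \<exists>a\<in>I. z = a \<otimes> x}" "r \<in> carrier R"
    then obtain a' where a: "a' \<in> I" "a = a' \<otimes> x" by auto
    then have "r \<otimes> a' \<in> I" "r \<otimes> a = (r \<otimes> a') \<otimes> x"
      using assms ideal_carr[OF assms(1)] ideal_mult_left[OF assms(1)] \<open>r \<in> carrier R\<close>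
      by (simp_all add: m_assoc)
    then show "r \<otimes> a \<in> {z. \<exists>a\<in>I. z = a \<otimes> x}" by blast
  qed
  have "I \<cdot> (PIdl x) \<subseteq> {z. \<exists>a\<in>I. z = a \<otimes> x}"
  proof (rule ideal_prod_subsetI[OF id])
    fix i j assume i: "i \<in> I" and "j \<in> PIdl x"
    then obtain r where "r \<in> carrier R" "j = x \<otimes> r" using PIdl_iff assms by auto
    then have "i \<otimes> j = (i \<otimes> r) \<otimes> x" "i \<otimes> r \<in> I"
      using i assms ideal_carr[OF assms(1)] ideal_mult_right by (auto simp: m_ac)
    then show "i \<otimes> j \<in> {z. \<exists>a\<in>I. z = a \<otimes> x}" by auto
  qed
  then show ?thesis
    using ideal_prod.prod[of _ I x "PIdl x"] cgenideal_self[OF assms(2)] by auto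
qed

lemma ideal_list_prod_Nil [simp]: "ideal_list_prod R [] = carrier R"
  by (simp add: ideal_list_prod_def)

lemma ideal_list_prod_Cons [simp]: "ideal_list_prod R (J # Js) = J \<cdot> ideal_list_prod R Js"
  by (simp add: ideal_list_prod_def)

lemma ideal_list_prod_ideal: "(\<And>J. J \<in> set Js \<Longrightarrow> ideal J R) \<Longrightarrow> ideal (ideal_list_prod R Js) R"
  by (induct Js) (auto intro: ideal_prod_is_ideal oneideal)

lemma ideal_list_prod_single: "ideal J R \<Longrightarrow> ideal_list_prod R [J] = J"
  by (simp add: ideal_prod_one)

lemma ideal_list_prod_remove1:
  assumes "\<And>J. J \<in> set Js \<Longrightarrow> ideal J R" "J \<in> set Js"
  shows "ideal_list_prod R Js = J \<cdot> ideal_list_prod R (remove1 J Js)"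
  using assms
proof (induct Js)
  case (Cons A Js)
  show ?case
  proof (cases "A = J")
    case False
    then have "ideal_list_prod R (A # Js) = A \<cdot> (J \<cdot> ideal_list_prod R (remove1 J Js))"
      using Cons by simp
    also have "\<dots> = J \<cdot> (A \<cdot> ideal_list_prod R (remove1 J Js))"
      using Cons.prems False
      by (intro ideal_prod_left_commute ideal_list_prod_ideal) (auto dest: notin_set_remove1)
    finally show ?thesis using False by simp
  qed simp
qed simp

lemma ideal_list_prod_subset:
  assumes "\<And>J. J \<in> set Js \<Longrightarrow> ideal J R" "J \<in> set Js"
  shows "ideal_list_prod R Js \<subseteq> J"
proof -
  have "ideal (ideal_list_prod R (remove1 J Js)) R"
    using assms by (intro ideal_list_prod_ideal) (auto dest: notin_set_remove1)
  then show ?thesis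
    using ideal_list_prod_remove1[OF assms] ideal_prod_subset_left assms by metis
qed

lemma primeideal_divides_ideal_list_prod:
  assumes "primeideal P R" "\<And>J. J \<in> set Js \<Longrightarrow> ideal J R" "ideal_list_prod R Js \<subseteq> P"
  shows "\<exists>J\<in>set Js. J \<subseteq> P"
  using assms(2,3)
proof (induct Js)
  case Nil
  then show ?case using prime_ideal_props[OF assms(1)] by auto
next
  case (Cons A Js)
  have "A \<subseteq> P \<or> ideal_list_prod R Js \<subseteq> P"
    using primeideal_divides_ideal_prod[OF assms(1), of A "ideal_list_prod R Js"] Cons.prems
      ideal_list_prod_ideal[of Js] by auto
  then show ?case using Cons by auto
qed

section \<open>Prime avoidance and maximal ideals\<close>

text \<open>Since \<open>P\<close> is prime, elements outside \<open>P\<close> chosen from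
  \<open>I\<close> and from each \<open>Q\<close> can be multiplied together without entering
  \<open>P\<close>.\<close>

lemma exists_in_all_but_prime:
  assumes "primeideal P R" "ideal I R" "\<not> I \<subseteq> P" "finite \<Q>"
    and "\<And>Q. Q \<in> \<Q> \<Longrightarrow> ideal Q R \<and> \<not> Q \<subseteq> P"
  shows "\<exists>v\<in>I. v \<notin> P \<and> (\<forall>Q\<in>\<Q>. v \<in> Q)"
  using assms(4,5)
proof (induct \<Q>)
  case empty
  then show ?case using assms by auto
next
  case (insert Q \<Q>)
  then obtain v where v: "v \<in> I" "v \<notin> P" "\<forall>Q\<in>\<Q>. v \<in> Q" by auto
  obtain q where q: "q \<in> Q" "q \<notin> P" using insert by auto
  have c: "v \<in> carrier R" "q \<in> carrier R" using v q assms insert ideal_carr by (metis insertI1)+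
  have "v \<otimes> q \<notin> P" using c v q prime_ideal_props(4)[OF assms(1)] by auto
  moreover have "v \<otimes> q \<in> I" using ideal_mult_right assms v c by auto
  moreover have "v \<otimes> q \<in> A" if "A \<in> insert Q \<Q>" for A
    using that insert.prems v q c ideal_mult_right ideal_mult_left by auto
  ultimately show ?case by blast
qed

text \<open>Induction on the set of primes: if \<open>w \<oplus> u\<close> avoids the old primes but
  falls into the new prime \<open>P\<close>, it is corrected by some \<open>v\<close> in
  \<open>I\<close> that lies in all old primes and outside \<open>P\<close>. Pairwise
  incomparability of the primes supplies such a \<open>v\<close>.\<close>

lemma coset_prime_avoidance:
  assumes "finite \<P>" "\<And>P. P \<in> \<P> \<Longrightarrow> primeideal P R" "\<And>P Q. \<lbrakk>P \<in> \<P>; Q \<in> \<P>; P \<subseteq> Q\<rbrakk> \<Longrightarrow> P = Q"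
    and "ideal I R" "\<And>P. P \<in> \<P> \<Longrightarrow> \<not> I \<subseteq> P" "w \<in> carrier R"
  shows "\<exists>u\<in>I. \<forall>P\<in>\<P>. w \<oplus> u \<notin> P"
  using assms(1-3,5)
proof (induct \<P>)
  case empty
  then show ?case using ideal_zero[OF assms(4)] by auto
next
  case (insert P \<P>)
  then obtain u where u: "u \<in> I" "\<forall>Q\<in>\<P>. w \<oplus> u \<notin> Q" by (metis insertCI)
  have uc: "u \<in> carrier R" using u assms(4) ideal_carr by fast
  show ?case
  proof (cases "w \<oplus> u \<in> P")
    case True
    have P: "primeideal P R" using insert by auto
    have "ideal Q R \<and> \<not> Q \<subseteq> P" if "Q \<in> \<P>" for Q
      using insert that by (metis insertCI prime_ideal_props(1))
    then obtain v where v: "v \<in> I" "v \<notin> P" "\<forall>Q\<in>\<P>. v \<in> Q"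
      using exists_in_all_but_prime[OF P assms(4) _ insert(1)] insert.prems by (metis insertI1)
    have vc: "v \<in> carrier R" using v assms(4) ideal_carr by fast
    have *: "w \<oplus> (u \<oplus> v) = (w \<oplus> u) \<oplus> v" using assms(6) uc vc by (simp add: a_assoc)
    have "w \<oplus> (u \<oplus> v) \<notin> Q" if "Q \<in> insert P \<P>" for Q
    proof (cases "Q = P")
      case True': True
      then show ?thesis
        using * True v ideal_add_cancel_left[OF prime_ideal_props(1)[OF P] True vc] by simp
    next
      case False
      then have Q: "Q \<in> \<P>" "primeideal Q R" using that insert by auto
      then show ?thesis
        using * u v ideal_add_cancel_right[OF prime_ideal_props(1)[OF Q(2)]] assms(6) uc by auto
    qed
    then show ?thesis using ideal_add[OF assms(4) u(1) v(1)] by (intro bexI) auto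
  qed (use u in auto)
qed

lemma exists_maximalideal:
  assumes "ideal I R" "I \<noteq> carrier R"
  shows "\<exists>m. maximalideal m R \<and> I \<subseteq> m"
proof -
  \<comment> \<open>Zorn's lemma is applied to the proper ideals above \<open>I\<close>. Properness,
    read as not containing \<open>\<one>\<close>, survives unions of chains.\<close>
  define S where "S = {J. ideal J R \<and> J \<noteq> carrier R \<and> I \<subseteq> J}"
  have S: "J \<in> S \<longleftrightarrow> ideal J R \<and> \<one> \<notin> J \<and> I \<subseteq> J" for J
    using one_notin_proper_ideal by (auto simp: S_def)
  have "\<exists>m\<in>S. \<forall>J\<in>S. m \<subseteq> J \<longrightarrow> J = m"
  proof (rule subset_Zorn_nonempty)
    show "S \<noteq> {}" using assms unfolding S_def by blast
    fix C assume C: "C \<noteq> {}" "subset.chain S C"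
    then have CS: "C \<subseteq> S" and "subset.chain {J. ideal J R} C"
      using S by (auto simp: pred_on.chain_def subset_iff)
    then have "ideal (\<Union>C) R" using chain_Union_is_ideal[of C] C(1) by simp
    moreover have "\<one> \<notin> \<Union>C" using CS S by blast
    moreover have "I \<subseteq> \<Union>C" using CS S C(1) by blast
    ultimately show "\<Union>C \<in> S" using S by simp
  qed
  then obtain m where m: "m \<in> S" "\<forall>J\<in>S. m \<subseteq> J \<longrightarrow> J = m" by (rule bexE)
  have "maximalideal m R"
  proof (rule maximalidealI)
    show "ideal m R" "carrier R \<noteq> m" using m(1) by (auto simp: S_def)
    fix J assume J: "ideal J R" "m \<subseteq> J"
    have "J \<in> S" if "J \<noteq> carrier R" using m(1) J that by (auto simp: S_def)
    then show "J = m \<or> J = carrier R" using m(2) J(2) by metis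
  qed
  then show ?thesis using m by (auto simp: S_def)
qed

lemma maximal_ideal_props:
  assumes "maximalideal m R"
  shows "primeideal m R" "ideal m R" "m \<noteq> carrier R"
    "\<And>J. \<lbrakk>ideal J R; m \<subseteq> J; J \<noteq> carrier R\<rbrakk> \<Longrightarrow> J = m"
proof -
  show "primeideal m R" by (rule maximalideal_prime[OF assms])
  then show "ideal m R" "m \<noteq> carrier R" using prime_ideal_props by auto
  show "J = m" if "ideal J R" "m \<subseteq> J" "J \<noteq> carrier R" for J
    using maximalideal.I_maximal[OF assms that(1,2) ideal_subset_carrier[OF that(1)]] that(3) by simp
qed

lemma exists_maximal_over_nonunit:
  assumes "a \<in> nonunits R"
  shows "\<exists>m. maximalideal m R \<and> a \<in> m"
proof -
  have "ideal (PIdl a) R" "PIdl a \<noteq> carrier R"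
    using PIdl_proper[OF assms] by (simp_all add: proper_ideal_def)
  then obtain m where "maximalideal m R" "PIdl a \<subseteq> m" using exists_maximalideal by blast
  moreover have "a \<in> PIdl a" using assms by (simp add: cgenideal_self nonunits_def)
  ultimately show ?thesis by blast
qed

section \<open>1-absorbing prime ideals\<close>

lemma prime_imp_OA:
  assumes "primeideal P R"
  shows "OA_ideal P R"
  using prime_ideal_props[OF assms] by (auto simp: OA_ideal_def proper_ideal_def nonunits_def)

text \<open>Take \<open>x\<close>, \<open>y\<close> outside \<open>J\<close> with product in
  \<open>J\<close>; both are nonunits. From a x y in \<open>J\<close> the 1-absorbing property gives
  a x in \<open>J\<close>, and then a b x in \<open>J\<close> gives a b in \<open>J\<close>.\<close>

lemma OA_nonprime_absorbs:
  assumes "OA_ideal J R" "\<not> primeideal J R" "a \<in> nonunits R" "b \<in> nonunits R"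
  shows "a \<otimes> b \<in> J"
proof -
  have J: "ideal J R" "J \<noteq> carrier R" using assms by (auto simp: OA_ideal_def proper_ideal_def)
  obtain x y where xy: "x \<in> carrier R" "y \<in> carrier R" "x \<otimes> y \<in> J" "x \<notin> J" "y \<notin> J"
    using ideal.primeidealCD[OF J(1) is_cring assms(2)] J(2) by blast
  have nu: "x \<in> nonunits R" "y \<in> nonunits R"
    using xy ideal_cancel_unit[OF J(1), of x y] ideal_cancel_unit[OF J(1), of y x] m_comm[of x y]
    by (auto simp: nonunits_def)
  have oa: "a \<otimes> b \<in> J \<or> c \<in> J"
    if "a \<in> nonunits R" "b \<in> nonunits R" "c \<in> nonunits R" "a \<otimes> b \<otimes> c \<in> J" for a b c
    using assms(1) that by (auto simp: OA_ideal_def)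
  have c: "a \<in> carrier R" "b \<in> carrier R" using assms by (auto simp: nonunits_def)
  have "a \<otimes> x \<otimes> y \<in> J" using ideal_mult_left[OF J(1) xy(3) c(1)] c xy by (simp add: m_assoc)
  then have "a \<otimes> x \<in> J" using oa nu assms xy by blast
  then have "b \<otimes> (a \<otimes> x) \<in> J" using ideal_mult_left[OF J(1) _ c(2)] by blast
  then have "a \<otimes> b \<otimes> x \<in> J" using c xy by (simp add: m_ac)
  then show ?thesis using oa nu assms xy by blast
qed

text \<open>Otherwise \<open>J\<close> contains the square of every nonunit, in particular of some
  \<open>m\<close> in \<open>M\<close> outside \<open>P\<close>, contradicting that \<open>P\<close>
  is prime.\<close>

lemma OA_below_nonmaximal_prime:
  assumes "OA_ideal J R" "J \<subseteq> P" "primeideal P R" "primeideal M R" "P \<subset> M"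
  shows "primeideal J R"
proof (rule ccontr)
  assume "\<not> primeideal J R"
  obtain m where m: "m \<in> M" "m \<notin> P" using assms by auto
  then have "m \<in> nonunits R"
    using proper_ideal_subset_nonunits prime_ideal_props[OF assms(4)] by blast
  then have "m \<otimes> m \<in> P" "m \<in> carrier R"
    using OA_nonprime_absorbs[OF assms(1) \<open>\<not> primeideal J R\<close>] assms(2) by (auto simp: nonunits_def)
  then show False using m prime_ideal_props[OF assms(3)] by auto
qed

lemma OA_ideal_proper:
  assumes "OA_ideal J R"
  shows "ideal J R" "J \<noteq> carrier R" "J \<subseteq> nonunits R"
  using assms proper_ideal_subset_nonunits by (auto simp: OA_ideal_def proper_ideal_def)

text \<open>The length of a chain counts inclusions, so a chain of three primes has length 2. This
  form removes the supremum from all later arguments.\<close>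

lemma krull_dim_le_one_iff:
  "krull_dim R \<le> 1 \<longleftrightarrow>
    (\<forall>P Q M. primeideal P R \<and> primeideal Q R \<and> primeideal M R \<longrightarrow> \<not> (P \<subset> Q \<and> Q \<subset> M))"
proof
  assume dim: "krull_dim R \<le> 1"
  show "\<forall>P Q M. primeideal P R \<and> primeideal Q R \<and> primeideal M R \<longrightarrow> \<not> (P \<subset> Q \<and> Q \<subset> M)"
  proof (intro allI impI notI)
    fix P Q M
    assume *: "primeideal P R \<and> primeideal Q R \<and> primeideal M R" "P \<subset> Q \<and> Q \<subset> M"
    define F where "F = (\<lambda>i::nat. if i = 0 then P else if i = 1 then Q else M)"
    have F: "(\<forall>i \<le> 2. primeideal (F i) R) \<and> (\<forall>i < 2. F i \<subset> F (Suc i))"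
      using * by (auto simp: F_def less_2_cases_iff)
    have "enat 2 \<in> {enat n |n. \<exists>P. (\<forall>i\<le>n. primeideal (P i) R) \<and> (\<forall>i<n. P i \<subset> P (Suc i))}"
      using F by blast
    then have "enat 2 \<le> krull_dim R" unfolding krull_dim_def by (rule Sup_upper)
    then show False using dim by (metis enat_ord_simps(1) not_less_eq_eq numeral_2_eq_2 One_nat_def one_enat_def order_trans order_refl)
  qed
next
  assume H: "\<forall>P Q M. primeideal P R \<and> primeideal Q R \<and> primeideal M R \<longrightarrow> \<not> (P \<subset> Q \<and> Q \<subset> M)"
  show "krull_dim R \<le> 1"
    unfolding krull_dim_def
  proof (rule Sup_least)
    fix x assume "x \<in> {enat n |n. \<exists>P. (\<forall>i\<le>n. primeideal (P i) R) \<and> (\<forall>i<n. P i \<subset> P (Suc i))}"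
    then obtain n P where x: "x = enat n" and P: "\<forall>i\<le>n. primeideal (P i) R" "\<forall>i<n. P i \<subset> P (Suc i)"
      by blast
    have "n \<le> 1"
    proof (rule ccontr)
      assume "\<not> n \<le> 1"
      then have "0 < n" "1 < n" "2 \<le> n" by auto
      then have "primeideal (P 0) R" "primeideal (P 1) R" "primeideal (P 2) R" "P 0 \<subset> P 1" "P 1 \<subset> P 2"
        using P by (auto simp: numeral_2_eq_2)
      then show False using H by blast
    qed
    then show "x \<le> 1" using x by (simp add: one_enat_def)
  qed
qed

section \<open>Two-generated ideals and the Krull dimension\<close>

text \<open>Some factor of (p) lies in \<open>P\<close>, and a 1-absorbing prime ideal below a
  nonmaximal prime is itself prime. The remaining factors are collected in \<open>K\<close>.\<close>

lemma principal_prime_factor: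
  assumes "has_OA_factorization (PIdl p) R" "primeideal P R" "primeideal M R" "P \<subset> M" "p \<in> P"
  obtains J K where "primeideal J R" "J \<subseteq> P" "ideal K R" "PIdl p = J \<cdot> K"
proof -
  obtain Js where Js: "\<forall>J\<in>set Js. OA_ideal J R" "PIdl p = ideal_list_prod R Js"
    using assms(1) by (auto simp: has_OA_factorization_def)
  have id: "ideal J R" if "J \<in> set Js" for J using Js that OA_ideal_proper by simp
  have "PIdl p \<subseteq> P" using cgenideal_minimal prime_ideal_props(1)[OF assms(2)] assms(5) by simp
  then obtain J where J: "J \<in> set Js" "J \<subseteq> P"
    using primeideal_divides_ideal_list_prod[OF assms(2), of Js] id Js(2) by blast
  have "primeideal J R"
    using OA_below_nonmaximal_prime[OF _ J(2) assms(2,3,4)] Js J(1) by simp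
  moreover have "ideal (ideal_list_prod R (remove1 J Js)) R"
    using id by (intro ideal_list_prod_ideal) (auto dest: notin_set_remove1)
  moreover have "PIdl p = J \<cdot> ideal_list_prod R (remove1 J Js)"
    using ideal_list_prod_remove1[of Js, OF id J(1)] Js(2) by simp
  ultimately show ?thesis using that J(2) by simp
qed

lemma two_generated_iff:
  assumes "x \<in> carrier R" "y \<in> carrier R"
  shows "z \<in> (PIdl x) <+>\<^bsub>R\<^esub> (PIdl y) \<longleftrightarrow> (\<exists>r\<in>carrier R. \<exists>s\<in>carrier R. z = x \<otimes> r \<oplus> y \<otimes> s)"
  unfolding sum_ideal_iff using PIdl_iff[OF assms(1)] PIdl_iff[OF assms(2)] by metis

lemma PIdl_two_generated:
  assumes "x \<in> carrier R"
  shows "two_generated (PIdl x) R"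
proof -
  have "PIdl x = (PIdl x) <+>\<^bsub>R\<^esub> (PIdl \<zero>)"
    using assms by (auto simp: two_generated_iff PIdl_iff)
  then show ?thesis using assms by (auto simp: two_generated_def)
qed

text \<open>The elements that become members of \<open>A\<close> in the localization at \<open>M\<close>.\<close>

lemma saturation_ideal:
  assumes "primeideal M R" "ideal A R"
  shows "ideal {x \<in> carrier R. \<exists>s\<in>carrier R - M. s \<otimes> x \<in> A} R"
proof (rule ideal_criterion)
  show "\<zero> \<in> {x \<in> carrier R. \<exists>s\<in>carrier R - M. s \<otimes> x \<in> A}"
    using prime_ideal_props(3)[OF assms(1)] ideal_zero[OF assms(2)] by (auto intro!: bexI[of _ \<one>])
next
  fix a b
  assume "a \<in> {x \<in> carrier R. \<exists>s\<in>carrier R - M. s \<otimes> x \<in> A}"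
    and "b \<in> {x \<in> carrier R. \<exists>s\<in>carrier R - M. s \<otimes> x \<in> A}"
  then obtain s t where *: "a \<in> carrier R" "b \<in> carrier R" "s \<in> carrier R - M" "t \<in> carrier R - M"
    "s \<otimes> a \<in> A" "t \<otimes> b \<in> A" by auto
  have "t \<otimes> (s \<otimes> a) \<oplus> s \<otimes> (t \<otimes> b) \<in> A"
    using * ideal_mult_left[OF assms(2)] ideal_add[OF assms(2)] by simp
  moreover have "t \<otimes> (s \<otimes> a) \<oplus> s \<otimes> (t \<otimes> b) = (s \<otimes> t) \<otimes> (a \<oplus> b)"
    using * by (simp add: r_distr m_ac)
  ultimately have "(s \<otimes> t) \<otimes> (a \<oplus> b) \<in> A" by simp
  moreover have "s \<otimes> t \<in> carrier R - M" using * prime_ideal_props(4)[OF assms(1)] by simp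
  ultimately show "a \<oplus> b \<in> {x \<in> carrier R. \<exists>s\<in>carrier R - M. s \<otimes> x \<in> A}"
    using * by blast
next
  fix a r
  assume "a \<in> {x \<in> carrier R. \<exists>s\<in>carrier R - M. s \<otimes> x \<in> A}" and r: "r \<in> carrier R"
  then obtain s where *: "a \<in> carrier R" "s \<in> carrier R - M" "s \<otimes> a \<in> A" by auto
  have "s \<otimes> (r \<otimes> a) = r \<otimes> (s \<otimes> a)" using * r by (simp add: m_lcomm)
  then have "s \<otimes> (r \<otimes> a) \<in> A" using ideal_mult_left[OF assms(2) *(3) r] by simp
  then show "r \<otimes> a \<in> {x \<in> carrier R. \<exists>s\<in>carrier R - M. s \<otimes> x \<in> A}"
    using * r by blast
qed auto

text \<open>
  Factor \<open>(a\<^sup>3, b)\<close> with \<open>a \<in> M - P\<close>. Locally at \<open>M\<close> it cannot be a single 1-absorbing prime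
  ideal, so it is a product of two ideals inside \<open>M\<close>. Modulo \<open>b\<close> these are locally
  generated by elements \<open>\<alpha>\<close> and \<open>\<beta>\<close> whose product is \<open>a\<^sup>3\<close> up to a factor outside \<open>M\<close>, and
  comparing \<open>b\<close> with that product gives \<open>b \<in> (\<alpha>\<beta>) + M b\<close>, hence \<open>b \<in> M b\<close>.
\<close>

lemma locally_principal_nonmaximal_prime_vanishes:
  assumes H: "\<And>I. \<lbrakk>proper_ideal I R; two_generated I R\<rbrakk> \<Longrightarrow> has_OA_factorization I R"
    and M: "primeideal M R" and P: "primeideal P R" and PM: "P \<subset> M"
    and b: "b \<in> P" and t: "t \<in> carrier R - M" and tP: "\<And>p. p \<in> P \<Longrightarrow> t \<otimes> p \<in> PIdl b"
  shows "\<exists>s\<in>carrier R - M. s \<otimes> b = \<zero>"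
proof -
  note Mi = prime_ideal_props(1)[OF M] and Pi = prime_ideal_props(1)[OF P]
  note Mp = prime_ideal_props(4)[OF M] and Pp = prime_ideal_props(4)[OF P]
  have bc: "b \<in> carrier R" using ideal_carr[OF Pi b] .
  have tc: "t \<in> carrier R" "t \<notin> M" using t by auto
  obtain a where a: "a \<in> M" "a \<notin> P" using PM by auto
  have ac: "a \<in> carrier R" using ideal_carr[OF Mi a(1)] .
  have anu: "a \<in> nonunits R"
    using proper_ideal_subset_nonunits[OF Mi prime_ideal_props(2)[OF M]] a(1) by auto
  \<comment> \<open>The exponent three fits the 1-absorbing condition: a factor containing a^3 must
    contain a^2.\<close>
  define d where "d = a \<otimes> a \<otimes> a"
  have dc: "d \<in> carrier R" and dM: "d \<in> M" and dP: "d \<notin> P"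
    using ac a ideal_mult_left[OF Mi a(1)] Pp by (simp_all add: d_def)
  define I where "I = (PIdl d) <+>\<^bsub>R\<^esub> (PIdl b)"
  have Iiff: "z \<in> I \<longleftrightarrow> (\<exists>r\<in>carrier R. \<exists>s\<in>carrier R. z = d \<otimes> r \<oplus> b \<otimes> s)" for z
    unfolding I_def by (rule two_generated_iff[OF dc bc])
  have Ii: "ideal I R" unfolding I_def using add_ideals cgenideal_ideal dc bc by simp
  have IM: "I \<subseteq> M"
  proof
    fix z assume "z \<in> I"
    then obtain r s where rs: "r \<in> carrier R" "s \<in> carrier R" "z = d \<otimes> r \<oplus> b \<otimes> s"
      unfolding Iiff by blast
    have "b \<in> M" using b PM by blast
    then show "z \<in> M"
      unfolding rs(3) using ideal_add[OF Mi] ideal_mult_right[OF Mi] dM rs(1,2) by simp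
  qed
  have "d = d \<otimes> \<one> \<oplus> b \<otimes> \<zero>" "b = d \<otimes> \<zero> \<oplus> b \<otimes> \<one>" using dc bc by simp_all
  then have dI: "d \<in> I" and bI: "b \<in> I" unfolding Iiff using one_closed zero_closed by blast+
  have "I \<noteq> carrier R" using IM prime_ideal_props(3)[OF M] by auto
  then have "proper_ideal I R" "two_generated I R"
    using Ii dc bc by (auto simp: proper_ideal_def two_generated_def I_def)
  then obtain Js where Js: "\<forall>J\<in>set Js. OA_ideal J R" "I = ideal_list_prod R Js"
    using H by (auto simp: has_OA_factorization_def)
  have id: "ideal J R" if "J \<in> set Js" for J using Js that OA_ideal_proper by simp
  obtain A where A: "A \<in> set Js" "A \<subseteq> M"
    using primeideal_divides_ideal_list_prod[OF M, of Js] id Js(2) IM by blast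
  define B where "B = ideal_list_prod R (remove1 A Js)"
  have Ai: "ideal A R" using id A by simp
  have Bi: "ideal B R" unfolding B_def
    using id by (intro ideal_list_prod_ideal) (auto dest: notin_set_remove1)
  have IAB: "I = A \<cdot> B" using ideal_list_prod_remove1[of Js, OF id A(1)] Js(2) by (simp add: B_def)
  \<comment> \<open>An element \<open>s\<close> of \<open>B\<close> outside \<open>M\<close> would
    put a^2 s into (a^3, b), because a^2 lies in \<open>A\<close>. Cancelling a^2 modulo the prime
    \<open>P\<close> would leave \<open>s\<close> in (a) + \<open>P\<close>, hence in
    \<open>M\<close>.\<close>
  have BM: "B \<subseteq> M"
  proof (rule ccontr)
    assume "\<not> B \<subseteq> M"
    then obtain s where s: "s \<in> B" "s \<notin> M" by auto
    have sc: "s \<in> carrier R" using ideal_carr[OF Bi s(1)] .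
    have OA: "a \<otimes> a \<in> A \<or> a \<in> A"
    proof -
      have "a \<otimes> a \<otimes> a \<in> A" using dI IAB ideal_prod_subset_left[OF Ai Bi] by (auto simp: d_def)
      then show ?thesis using Js A(1) anu unfolding OA_ideal_def by blast
    qed
    then have "a \<otimes> a \<in> A" using ideal_mult_left[OF Ai _ ac] by blast
    then have "(a \<otimes> a) \<otimes> s \<in> I" using s by (simp add: IAB ideal_prod.prod)
    then obtain r q where rq: "r \<in> carrier R" "q \<in> carrier R" "(a \<otimes> a) \<otimes> s = d \<otimes> r \<oplus> b \<otimes> q"
      by (auto simp: Iiff)
    have "(a \<otimes> a) \<otimes> (s \<ominus> a \<otimes> r) = (a \<otimes> a) \<otimes> s \<ominus> d \<otimes> r"
      unfolding d_def using ac sc rq(1) by algebra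
    also have "\<dots> = b \<otimes> q" unfolding rq(3) using dc rq(1,2) bc by algebra
    finally have "(a \<otimes> a) \<otimes> (s \<ominus> a \<otimes> r) \<in> P" using ideal_mult_right[OF Pi b] rq by simp
    then have "s \<ominus> a \<otimes> r \<in> M" using a ac sc rq Pp PM by auto
    then have "s \<in> M" using ideal_minusD[OF Mi] ideal_mult_right[OF Mi a(1)] sc rq by blast
    then show False using s by simp
  qed
  \<comment> \<open>\<open>K\<close> isolates the elements that do not generate (d) locally modulo
    \<open>P\<close>. If all products from \<open>A\<close> and \<open>B\<close> were in
    \<open>K\<close>, then d (1 - m) would lie in \<open>P\<close> for some \<open>m\<close> in
    \<open>M\<close>, which forces \<open>\<one>\<close> into \<open>M\<close>. So a single product
    \<open>\<alpha> \<otimes> \<beta>\<close> is outside \<open>K\<close>, and its coefficient at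
    \<open>d\<close> is outside \<open>M\<close>.\<close>
  define K where "K = M \<cdot> (PIdl d) <+>\<^bsub>R\<^esub> P"
  have Ki: "ideal K R"
    unfolding K_def using add_ideals ideal_prod_is_ideal cgenideal_ideal Mi Pi dc by simp
  have Kiff: "z \<in> K \<longleftrightarrow> (\<exists>m\<in>M. \<exists>p\<in>P. z = m \<otimes> d \<oplus> p)" for z
    unfolding K_def sum_ideal_iff using prod_PIdl_iff[OF Mi dc] by metis
  have "\<exists>\<alpha>\<in>A. \<exists>\<beta>\<in>B. \<alpha> \<otimes> \<beta> \<notin> K"
  proof (rule ccontr)
    assume "\<not> ?thesis"
    then have "A \<cdot> B \<subseteq> K" using ideal_prod_subsetI[OF Ki] by blast
    then obtain m p where mp: "m \<in> M" "p \<in> P" "d = m \<otimes> d \<oplus> p" using dI IAB Kiff by blast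
    have c: "m \<in> carrier R" "p \<in> carrier R" using ideal_carr[OF Mi] ideal_carr[OF Pi] mp by auto
    have "d \<otimes> (\<one> \<ominus> m) = d \<ominus> m \<otimes> d" using dc c by algebra
    also have "\<dots> = (m \<otimes> d \<oplus> p) \<ominus> m \<otimes> d" using mp(3) by simp
    also have "\<dots> = p" using dc c by algebra
    finally have "\<one> \<ominus> m \<in> P" using mp dP dc c Pp by (metis minus_closed one_closed)
    then have "\<one> \<in> M" using ideal_minusD[OF Mi _ mp(1)] PM by auto
    then show False using prime_ideal_props(3)[OF M] by simp
  qed
  then obtain \<alpha> \<beta> where \<alpha>\<beta>: "\<alpha> \<in> A" "\<beta> \<in> B" "\<alpha> \<otimes> \<beta> \<notin> K" by auto
  have c: "\<alpha> \<in> carrier R" "\<beta> \<in> carrier R" using ideal_carr[OF Ai] ideal_carr[OF Bi] \<alpha>\<beta> by auto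
  have "\<alpha> \<otimes> \<beta> \<in> I" using \<alpha>\<beta> by (simp add: IAB ideal_prod.prod)
  then obtain r s where rs: "r \<in> carrier R" "s \<in> carrier R" "\<alpha> \<otimes> \<beta> = d \<otimes> r \<oplus> b \<otimes> s"
    by (auto simp: Iiff)
  have rM: "r \<notin> M"
  proof
    assume "r \<in> M"
    moreover have "\<alpha> \<otimes> \<beta> = r \<otimes> d \<oplus> b \<otimes> s" using rs dc by (simp add: m_comm)
    ultimately show False using \<alpha>\<beta>(3) Kiff ideal_mult_right[OF Pi b] rs by blast
  qed
  have "\<alpha> \<otimes> \<beta> \<notin> P"
  proof
    assume "\<alpha> \<otimes> \<beta> \<in> P"
    moreover have "\<alpha> \<otimes> \<beta> = \<zero> \<otimes> d \<oplus> \<alpha> \<otimes> \<beta>" using c dc by simp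
    ultimately show False using \<alpha>\<beta>(3) Kiff ideal_zero[OF Mi] by blast
  qed
  then have nP: "\<alpha> \<otimes> \<beta> \<notin> P" "\<alpha> \<notin> P" "\<beta> \<notin> P" using Pp c by auto
  \<comment> \<open>Both sides are compared after multiplying by \<open>\<delta>\<close>, which is
    then cancelled modulo \<open>P\<close>; the factor \<open>t\<close> moves the resulting element
    of \<open>P\<close> into (b). The fact is used with the roles of \<open>\<alpha>\<close> and
    \<open>\<beta>\<close> in either order, so these generate \<open>A\<close> and \<open>B\<close>
    locally modulo \<open>b\<close>.\<close>
  have gen: "\<exists>u\<in>carrier R. \<exists>v\<in>carrier R. (t \<otimes> r) \<otimes> x = \<gamma> \<otimes> u \<oplus> b \<otimes> v"
    if x: "x \<in> carrier R" "\<gamma> \<in> carrier R" "\<delta> \<in> carrier R" "\<delta> \<notin> P"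
      and eq: "\<gamma> \<otimes> \<delta> = d \<otimes> r \<oplus> b \<otimes> s" and xI: "x \<otimes> \<delta> \<in> I" for x \<gamma> \<delta>
  proof -
    obtain y z where yz: "y \<in> carrier R" "z \<in> carrier R" "x \<otimes> \<delta> = d \<otimes> y \<oplus> b \<otimes> z"
      using xI by (auto simp: Iiff)
    have "\<delta> \<otimes> (r \<otimes> x \<ominus> \<gamma> \<otimes> y) = r \<otimes> (x \<otimes> \<delta>) \<ominus> (\<gamma> \<otimes> \<delta>) \<otimes> y"
      using x(1-3) rs(1,2) yz(1,2) by algebra
    also have "\<dots> = r \<otimes> (d \<otimes> y \<oplus> b \<otimes> z) \<ominus> (d \<otimes> r \<oplus> b \<otimes> s) \<otimes> y"
      using yz(3) eq by simp
    also have "\<dots> = b \<otimes> (r \<otimes> z \<ominus> s \<otimes> y)"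
      using rs(1,2) yz(1,2) dc bc by algebra
    finally have "\<delta> \<otimes> (r \<otimes> x \<ominus> \<gamma> \<otimes> y) \<in> P"
      using ideal_mult_right[OF Pi b] rs yz by simp
    then have "r \<otimes> x \<ominus> \<gamma> \<otimes> y \<in> P" using Pp x rs yz by simp
    then obtain w where w: "w \<in> carrier R" "t \<otimes> (r \<otimes> x \<ominus> \<gamma> \<otimes> y) = b \<otimes> w"
      using tP PIdl_iff[OF bc] by blast
    have "(t \<otimes> r) \<otimes> x = \<gamma> \<otimes> (t \<otimes> y) \<oplus> t \<otimes> (r \<otimes> x \<ominus> \<gamma> \<otimes> y)"
      using x(1,2) rs(1,2) yz(1,2) tc(1) by algebra
    then show ?thesis using w yz tc by auto
  qed
  define c' where "c' = t \<otimes> r"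
  have c'c: "c' \<in> carrier R" and c'M: "c' \<notin> M" using tc rs rM Mp by (auto simp: c'_def)
  \<comment> \<open>Multiplying the local expressions for \<open>x\<close> in \<open>A\<close> and
    \<open>y\<close> in \<open>B\<close> leaves a multiple of
    \<open>\<alpha> \<otimes> \<beta>\<close> and terms in \<open>b\<close> whose coefficients
    contain \<open>\<alpha>\<close> or \<open>y\<close>, both in \<open>M\<close>. Hence
    \<open>L\<close> contains the ideal \<open>A \<cdot> B\<close>, and with it \<open>b\<close>, up
    to the factor c'^2.\<close>
  define L where "L = M \<cdot> (PIdl b) <+>\<^bsub>R\<^esub> (PIdl (\<alpha> \<otimes> \<beta>))"
  have Li: "ideal L R"
    unfolding L_def using add_ideals ideal_prod_is_ideal cgenideal_ideal Mi c bc by simp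
  have Liff: "z \<in> L \<longleftrightarrow> (\<exists>m\<in>M. \<exists>w\<in>carrier R. z = m \<otimes> b \<oplus> (\<alpha> \<otimes> \<beta>) \<otimes> w)" for z
    unfolding L_def sum_ideal_iff
    using prod_PIdl_iff[OF Mi bc] PIdl_iff[of "\<alpha> \<otimes> \<beta>"] c by (metis m_closed)
  have "A \<cdot> B \<subseteq> {x \<in> carrier R. \<forall>q\<in>{c' \<otimes> c'}. x \<otimes> q \<in> L}"
  proof (rule ideal_prod_subsetI)
    show "ideal {x \<in> carrier R. \<forall>q\<in>{c' \<otimes> c'}. x \<otimes> q \<in> L} R"
      by (rule ideal_colon[OF Li]) (use c'c in simp)
    fix x y assume xy: "x \<in> A" "y \<in> B"
    have xyc: "x \<in> carrier R" "y \<in> carrier R" using ideal_carr[OF Ai] ideal_carr[OF Bi] xy by auto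
    have "x \<otimes> \<beta> \<in> I" using xy \<alpha>\<beta> by (simp add: IAB ideal_prod.prod)
    then obtain u v where uv: "u \<in> carrier R" "v \<in> carrier R" "c' \<otimes> x = \<alpha> \<otimes> u \<oplus> b \<otimes> v"
      using gen[of x \<alpha> \<beta>] xyc c nP rs by (auto simp: c'_def)
    have "y \<otimes> \<alpha> \<in> I" using xy \<alpha>\<beta> xyc c by (simp add: IAB ideal_prod.prod m_comm[of y \<alpha>])
    moreover have "\<beta> \<otimes> \<alpha> = d \<otimes> r \<oplus> b \<otimes> s" using rs c by (simp add: m_comm)
    ultimately obtain u' v' where uv': "u' \<in> carrier R" "v' \<in> carrier R" "c' \<otimes> y = \<beta> \<otimes> u' \<oplus> b \<otimes> v'"
      using gen[of y \<beta> \<alpha>] xyc c nP by (auto simp: c'_def)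
    have "(x \<otimes> y) \<otimes> (c' \<otimes> c') = (c' \<otimes> x) \<otimes> (c' \<otimes> y)" using xyc c'c by algebra
    also have "\<dots> = (\<alpha> \<otimes> u) \<otimes> (c' \<otimes> y) \<oplus> (b \<otimes> v) \<otimes> (c' \<otimes> y)"
      unfolding uv(3) using c bc uv(1,2) xyc c'c by algebra
    also have "\<dots> = (\<alpha> \<otimes> u) \<otimes> (\<beta> \<otimes> u' \<oplus> b \<otimes> v') \<oplus> (b \<otimes> v) \<otimes> (c' \<otimes> y)"
      by (simp only: uv'(3))
    also have "\<dots> = (\<alpha> \<otimes> (u \<otimes> v') \<oplus> y \<otimes> (v \<otimes> c')) \<otimes> b \<oplus> (\<alpha> \<otimes> \<beta>) \<otimes> (u \<otimes> u')"
      using c bc uv(1,2) uv'(1,2) xyc c'c by algebra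
    finally have "(x \<otimes> y) \<otimes> (c' \<otimes> c')
      = (\<alpha> \<otimes> (u \<otimes> v') \<oplus> y \<otimes> (v \<otimes> c')) \<otimes> b \<oplus> (\<alpha> \<otimes> \<beta>) \<otimes> (u \<otimes> u')" .
    moreover have "\<alpha> \<in> M" "y \<in> M" using \<alpha>\<beta>(1) xy(2) A(2) BM by auto
    then have "\<alpha> \<otimes> (u \<otimes> v') \<oplus> y \<otimes> (v \<otimes> c') \<in> M"
      using uv(1,2) uv'(1,2) c'c ideal_mult_right[OF Mi] ideal_add[OF Mi] by simp
    ultimately show "x \<otimes> y \<in> {x \<in> carrier R. \<forall>q\<in>{c' \<otimes> c'}. x \<otimes> q \<in> L}"
      using Liff xyc uv uv' by auto
  qed
  then have "b \<otimes> (c' \<otimes> c') \<in> L" using bI IAB by auto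
  then obtain m w where mw: "m \<in> M" "w \<in> carrier R"
    "b \<otimes> (c' \<otimes> c') = m \<otimes> b \<oplus> (\<alpha> \<otimes> \<beta>) \<otimes> w" using Liff by auto
  have mc: "m \<in> carrier R" using ideal_carr[OF Mi mw(1)] .
  have "(\<alpha> \<otimes> \<beta>) \<otimes> w = (m \<otimes> b \<oplus> (\<alpha> \<otimes> \<beta>) \<otimes> w) \<ominus> m \<otimes> b" using c mw(2) mc bc by algebra
  also have "\<dots> = b \<otimes> (c' \<otimes> c') \<ominus> m \<otimes> b" using mw(3) by simp
  also have "\<dots> = b \<otimes> (c' \<otimes> c' \<ominus> m)" using mc bc c'c by algebra
  finally have eq: "(\<alpha> \<otimes> \<beta>) \<otimes> w = b \<otimes> (c' \<otimes> c' \<ominus> m)" .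
  then have "(\<alpha> \<otimes> \<beta>) \<otimes> w \<in> P" using ideal_mult_right[OF Pi b] mc c'c by simp
  then have "w \<in> P" using Pp nP c mw by simp
  then obtain w' where w': "w' \<in> carrier R" "t \<otimes> w = b \<otimes> w'" using tP PIdl_iff[OF bc] by blast
  \<comment> \<open>As \<open>w\<close> lies in \<open>P\<close>, \<open>t \<otimes> w\<close> is
    the multiple \<open>b \<otimes> w'\<close>. Multiplying \<open>eq\<close> by \<open>t\<close>
    therefore gives \<open>e \<otimes> b = \<zero>\<close>, and \<open>e\<close> is congruent modulo
    \<open>M\<close> to t c'^2, which is outside \<open>M\<close>.\<close>
  define e where "e = t \<otimes> (c' \<otimes> c' \<ominus> m) \<ominus> (\<alpha> \<otimes> \<beta>) \<otimes> w'"
  have ec: "e \<in> carrier R" using tc c'c mc c w' by (simp add: e_def)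
  have "t \<otimes> (b \<otimes> (c' \<otimes> c' \<ominus> m)) = t \<otimes> ((\<alpha> \<otimes> \<beta>) \<otimes> w)" using eq by simp
  also have "\<dots> = (\<alpha> \<otimes> \<beta>) \<otimes> (t \<otimes> w)" using tc c mw by (simp add: m_ac)
  also have "\<dots> = (\<alpha> \<otimes> \<beta>) \<otimes> (b \<otimes> w')" using w' by simp
  finally have eq2: "t \<otimes> (b \<otimes> (c' \<otimes> c' \<ominus> m)) = (\<alpha> \<otimes> \<beta>) \<otimes> (b \<otimes> w')" .
  have "e \<otimes> b = t \<otimes> (b \<otimes> (c' \<otimes> c' \<ominus> m)) \<ominus> (\<alpha> \<otimes> \<beta>) \<otimes> (b \<otimes> w')"
    unfolding e_def using tc c'c mc c w'(1) bc by algebra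
  also have "\<dots> = \<zero>" using eq2 c bc w' by (simp add: r_neg a_minus_def)
  finally have "e \<otimes> b = \<zero>" .
  moreover have "e \<notin> M"
  proof
    assume "e \<in> M"
    have "\<alpha> \<otimes> (\<beta> \<otimes> w') \<in> M" using \<alpha>\<beta>(1) A(2) ideal_mult_right[OF Mi] c w' by auto
    then have "(\<alpha> \<otimes> \<beta>) \<otimes> w' \<in> M" using c w' by (simp add: m_assoc)
    then have "t \<otimes> (c' \<otimes> c' \<ominus> m) \<in> M"
      using ideal_minusD[OF Mi] \<open>e \<in> M\<close> tc c'c mc unfolding e_def by blast
    then have "c' \<otimes> c' \<ominus> m \<in> M" using Mp tc c'c mc by simp
    then have "c' \<otimes> c' \<in> M" using ideal_minusD[OF Mi _ mw(1)] c'c by simp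
    then show False using Mp c'c c'M by simp
  qed
  ultimately show ?thesis using ec by blast
qed

text \<open>Write (p) as \<open>J \<cdot> K\<close> with \<open>J\<close> a prime inside
  \<open>P\<close>. If \<open>K\<close> lies in \<open>M\<close>, then \<open>p\<close> is in
  \<open>M \<cdot> P\<close>. Otherwise an element of \<open>K\<close> outside \<open>M\<close>
  multiplies \<open>J\<close> into (p), so \<open>J\<close> is locally generated by \<open>p\<close>
  and the vanishing lemma applies to \<open>J\<close>.\<close>

lemma nonmaximal_prime_locally_divisible:
  assumes H: "\<And>I. \<lbrakk>proper_ideal I R; two_generated I R\<rbrakk> \<Longrightarrow> has_OA_factorization I R"
    and M: "primeideal M R" and P: "primeideal P R" and PM: "P \<subset> M" and p: "p \<in> P"
  shows "\<exists>s\<in>carrier R - M. s \<otimes> p \<in> M \<cdot> P"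
proof -
  note Mi = prime_ideal_props(1)[OF M] and Pi = prime_ideal_props(1)[OF P]
  have pc: "p \<in> carrier R" and pnu: "p \<in> nonunits R"
    using ideal_carr[OF Pi p] proper_ideal_subset_nonunits[OF Pi prime_ideal_props(2)[OF P]] p by auto
  obtain J K where JK: "primeideal J R" "J \<subseteq> P" "ideal K R" "PIdl p = J \<cdot> K"
    using principal_prime_factor[OF H[OF PIdl_proper[OF pnu] PIdl_two_generated[OF pc]] P M PM p] .
  note Ji = prime_ideal_props(1)[OF JK(1)]
  have pJK: "p \<in> J \<cdot> K" using cgenideal_self[OF pc] JK(4) by simp
  show ?thesis
  proof (cases "K \<subseteq> M")
    case True
    have "p \<in> K \<cdot> J" using pJK ideal_prod_commute[OF Ji JK(3)] by simp
    then have "p \<in> M \<cdot> P" using ideal_prod_mono[OF True JK(2)] by auto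
    then have "\<one> \<otimes> p \<in> M \<cdot> P" using pc by simp
    then show ?thesis using prime_ideal_props(3)[OF M] by blast
  next
    case False
    then obtain s where s: "s \<in> K" "s \<notin> M" by auto
    have sc: "s \<in> carrier R" using ideal_carr[OF JK(3) s(1)] .
    have "s \<otimes> j \<in> PIdl p" if "j \<in> J" for j
      using that s sc ideal_carr[OF Ji] by (simp add: JK(4) m_comm ideal_prod.prod)
    moreover have "J \<subset> M" using JK(2) PM by auto
    moreover have "p \<in> J" using pJK ideal_prod_subset_left[OF Ji JK(3)] by auto
    ultimately obtain s' where "s' \<in> carrier R - M" "s' \<otimes> p = \<zero>"
      using locally_principal_nonmaximal_prime_vanishes[OF H M JK(1), of p s] s sc by blast
    then show ?thesis using ideal_zero[OF ideal_prod_is_ideal[OF Mi Pi]] by metis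
  qed
qed

text \<open>The previous lemma, applied to the prime factor \<open>J\<close> of (p), gives (p) =
  \<open>M\<close> (p) locally at \<open>M\<close>. Thus s p = m p with \<open>s\<close> outside
  \<open>M\<close> and \<open>m\<close> in \<open>M\<close>, and s - m kills
  \<open>p\<close>.\<close>

lemma nonmaximal_prime_locally_zero:
  assumes H: "\<And>I. \<lbrakk>proper_ideal I R; two_generated I R\<rbrakk> \<Longrightarrow> has_OA_factorization I R"
    and M: "primeideal M R" and P: "primeideal P R" and PM: "P \<subset> M" and p: "p \<in> P"
  shows "\<exists>s\<in>carrier R - M. s \<otimes> p = \<zero>"
proof -
  note Mi = prime_ideal_props(1)[OF M] and Pi = prime_ideal_props(1)[OF P]
  have pc: "p \<in> carrier R" and pnu: "p \<in> nonunits R"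
    using ideal_carr[OF Pi p] proper_ideal_subset_nonunits[OF Pi prime_ideal_props(2)[OF P]] p by auto
  obtain J K where JK: "primeideal J R" "J \<subseteq> P" "ideal K R" "PIdl p = J \<cdot> K"
    using principal_prime_factor[OF H[OF PIdl_proper[OF pnu] PIdl_two_generated[OF pc]] P M PM p] .
  note Ji = prime_ideal_props(1)[OF JK(1)]
  have pI: "ideal (PIdl p) R" by (rule cgenideal_ideal[OF pc])
  \<comment> \<open>The multiplier \<open>s\<close> depends on \<open>j\<close>; working inside the
    saturation, which is an ideal, takes care of sums of products.\<close>
  have "J \<cdot> K \<subseteq> {x \<in> carrier R. \<exists>s\<in>carrier R - M. s \<otimes> x \<in> M \<cdot> (PIdl p)}"
  proof (rule ideal_prod_subsetI[OF saturation_ideal[OF M ideal_prod_is_ideal[OF Mi pI]]])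
    fix j k assume jk: "j \<in> J" "k \<in> K"
    have c: "j \<in> carrier R" "k \<in> carrier R" using ideal_carr[OF Ji] ideal_carr[OF JK(3)] jk by auto
    have "J \<subset> M" using JK(2) PM by auto
    then obtain s where s: "s \<in> carrier R - M" "s \<otimes> j \<in> M \<cdot> J"
      using nonmaximal_prime_locally_divisible[OF H M JK(1) _ jk(1)] by blast
    then have "(s \<otimes> j) \<otimes> k \<in> (M \<cdot> J) \<cdot> K" using jk by (simp add: ideal_prod.prod)
    then have "s \<otimes> (j \<otimes> k) \<in> M \<cdot> (PIdl p)"
      using s c ideal_prod_assoc[OF Mi Ji JK(3)] JK(4) by (simp add: m_assoc)
    then show "j \<otimes> k \<in> {x \<in> carrier R. \<exists>s\<in>carrier R - M. s \<otimes> x \<in> M \<cdot> (PIdl p)}"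
      using s c by auto
  qed
  then obtain s where s: "s \<in> carrier R - M" "s \<otimes> p \<in> M \<cdot> (PIdl p)"
    using cgenideal_self[OF pc] JK(4) by auto
  then obtain m where m: "m \<in> M" "s \<otimes> p = m \<otimes> p" using prod_PIdl_iff[OF Mi pc] by blast
  have mc: "m \<in> carrier R" using ideal_carr[OF Mi m(1)] .
  have "(s \<ominus> m) \<otimes> p = s \<otimes> p \<ominus> m \<otimes> p" using s mc pc by (simp add: a_minus_def l_distr l_minus)
  then have "(s \<ominus> m) \<otimes> p = \<zero>" using m mc pc by (simp add: r_neg a_minus_def)
  moreover have "s \<ominus> m \<in> carrier R - M" using s m mc ideal_minusD[OF Mi] by auto
  ultimately show ?thesis by blast
qed

text \<open>In a chain of three primes, an element \<open>q\<close> of the middle one outside the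
  smallest is killed by some \<open>s\<close> outside the largest. Then
  \<open>s \<otimes> q = \<zero>\<close> lies in the smallest prime, which contains neither
  factor.\<close>

theorem two_generated_factorizations_imp_dim_le_one:
  assumes H: "\<And>I. \<lbrakk>proper_ideal I R; two_generated I R\<rbrakk> \<Longrightarrow> has_OA_factorization I R"
  shows "krull_dim R \<le> 1"
  unfolding krull_dim_le_one_iff
proof (intro allI impI notI)
  fix P Q M
  assume prime: "primeideal P R \<and> primeideal Q R \<and> primeideal M R" and sub: "P \<subset> Q \<and> Q \<subset> M"
  obtain q where q: "q \<in> Q" "q \<notin> P" using sub by auto
  obtain s where s: "s \<in> carrier R - M" "s \<otimes> q = \<zero>"
    using nonmaximal_prime_locally_zero[OF H, of M Q q] prime sub q by blast
  have "q \<in> carrier R" using prime_ideal_props(1) ideal_carr q prime by metis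
  moreover have "s \<otimes> q \<in> P" using s ideal_zero prime_ideal_props(1) prime by metis
  ultimately have "s \<in> P" using prime_ideal_props(4) prime s q by (metis DiffD1)
  then show False using sub s by auto
qed

end

section \<open>Rings of dimension at most one with factorizations of principal ideals\<close>

text \<open>These are the hypotheses of condition (3). Nontriviality makes \<open>\<zero>\<close> a
  nonunit, so that the zero ideal has a factorization too.\<close>

locale OA_principal = cring +
  assumes nontrivial: "\<one> \<noteq> \<zero>"
    and dim: "krull_dim R \<le> 1"
    and principal_factorization: "\<And>x. x \<in> nonunits R \<Longrightarrow> has_OA_factorization (PIdl x) R"
begin

text \<open>Asking for a larger prime, instead of denying maximality, provides directly the witness
  \<open>M\<close> that the dimension bound and \<open>OA_below_nonmaximal_prime\<close> take as
  input.\<close>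

definition nonmax_primes :: "'a set set" where
  "nonmax_primes = {P. primeideal P R \<and> (\<exists>M. primeideal M R \<and> P \<subset> M)}"

lemma zero_nonunit: "\<zero> \<in> nonunits R"
  using nontrivial by (auto simp: nonunits_def Units_def)

lemma nonmax_primesD: "P \<in> nonmax_primes \<Longrightarrow> primeideal P R"
  by (simp add: nonmax_primes_def)

lemma nonmax_prime_minimal:
  assumes "P \<in> nonmax_primes" "primeideal Q R" "Q \<subseteq> P"
  shows "Q = P"
proof (rule ccontr)
  assume "Q \<noteq> P"
  obtain M where "primeideal P R" "primeideal M R" "P \<subset> M"
    using assms(1) by (auto simp: nonmax_primes_def)
  then show False using dim assms(2,3) \<open>Q \<noteq> P\<close> unfolding krull_dim_le_one_iff by blast
qed

lemma prime_maximal_or_nonmax: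
  assumes "primeideal P R" "P \<notin> nonmax_primes"
  shows "maximalideal P R"
proof -
  obtain m where m: "maximalideal m R" "P \<subseteq> m"
    using exists_maximalideal[OF prime_ideal_props(1,2)[OF assms(1)]] by blast
  then have "P = m" using assms maximal_ideal_props(1)[OF m(1)] by (auto simp: nonmax_primes_def)
  then show ?thesis using m by simp
qed

lemma OA_below_nonmax_prime_eq:
  assumes "P \<in> nonmax_primes" "OA_ideal J R" "J \<subseteq> P"
  shows "J = P"
proof -
  obtain M where "primeideal P R" "primeideal M R" "P \<subset> M"
    using assms(1) by (auto simp: nonmax_primes_def)
  then have "primeideal J R" using OA_below_nonmaximal_prime[OF assms(2,3)] by simp
  then show ?thesis using nonmax_prime_minimal assms by simp
qed

lemma nonmax_prime_in_factorization:
  assumes "P \<in> nonmax_primes" "\<forall>J\<in>set Js. OA_ideal J R" "ideal_list_prod R Js \<subseteq> P"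
  shows "P \<in> set Js"
proof -
  have "\<exists>J\<in>set Js. J \<subseteq> P"
    by (rule primeideal_divides_ideal_list_prod[OF nonmax_primesD[OF assms(1)] _ assms(3)])
      (use assms(2) OA_ideal_proper(1) in simp)
  then obtain J where J: "J \<in> set Js" "J \<subseteq> P" by blast
  then have "J = P" using OA_below_nonmax_prime_eq[OF assms(1)] assms(2) by simp
  then show ?thesis using J by simp
qed

text \<open>Every nonmaximal prime contains the zero ideal, and therefore occurs in one fixed
  factorization of it.\<close>

lemma finite_nonmax_primes: "finite nonmax_primes"
proof -
  obtain Js where Js: "\<forall>J\<in>set Js. OA_ideal J R" "PIdl \<zero> = ideal_list_prod R Js"
    using principal_factorization[OF zero_nonunit] by (auto simp: has_OA_factorization_def)
  have "P \<in> set Js" if P: "P \<in> nonmax_primes" for P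
  proof -
    have "ideal_list_prod R Js \<subseteq> P"
      unfolding Js(2)[symmetric] PIdl_zero
      using ideal_zero[OF prime_ideal_props(1)[OF nonmax_primesD[OF P]]] by simp
    then show ?thesis using nonmax_prime_in_factorization[OF P Js(1)] by simp
  qed
  then have "nonmax_primes \<subseteq> set Js" by blast
  then show ?thesis using finite_subset by blast
qed

lemma nonmax_prime_divides:
  assumes "P \<in> nonmax_primes" "p \<in> P"
  obtains K where "ideal K R" "PIdl p = P \<cdot> K"
proof -
  note P = nonmax_primesD[OF assms(1)]
  obtain M where M: "primeideal M R" "P \<subset> M" using assms(1) by (auto simp: nonmax_primes_def)
  have "p \<in> nonunits R" using proper_ideal_subset_nonunits[OF prime_ideal_props(1,2)[OF P]] assms by auto
  from principal_factorization[OF this]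
  obtain J K where JK: "primeideal J R" "J \<subseteq> P" "ideal K R" "PIdl p = J \<cdot> K"
    using principal_prime_factor[OF _ P M assms(2)] by blast
  then have "J = P" using nonmax_prime_minimal[OF assms(1)] by simp
  then show ?thesis using that JK by simp
qed

text \<open>Minimality makes distinct nonmaximal primes incomparable. The shift by \<open>w\<close>
  allows an element to be moved off these primes without changing its class modulo \<open>I\<close>,
  for example while staying outside M^2.\<close>

lemma avoid_nonmax_primes:
  assumes "ideal I R" "\<And>P. P \<in> nonmax_primes \<Longrightarrow> \<not> I \<subseteq> P" "w \<in> carrier R"
  obtains u where "u \<in> I" "\<And>P. P \<in> nonmax_primes \<Longrightarrow> w \<oplus> u \<notin> P"
proof -
  have "\<exists>u\<in>I. \<forall>P\<in>nonmax_primes. w \<oplus> u \<notin> P"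
  proof (rule coset_prime_avoidance[OF finite_nonmax_primes _ _ assms(1) _ assms(3)])
    show "P = Q" if "P \<in> nonmax_primes" "Q \<in> nonmax_primes" "P \<subseteq> Q" for P Q
      using nonmax_prime_minimal[OF that(2) nonmax_primesD[OF that(1)] that(3)] .
  qed (use nonmax_primesD assms(2) in auto)
  then show ?thesis using that by blast
qed

lemma maximal_not_below_nonmax_prime:
  assumes "maximalideal M R" "P \<in> nonmax_primes"
  shows "\<not> M \<subseteq> P"
proof
  assume "M \<subseteq> P"
  obtain M' where M': "primeideal M' R" "P \<subset> M'" using assms by (auto simp: nonmax_primes_def)
  then have "M' = M"
    using maximal_ideal_props(4)[OF assms(1)] prime_ideal_props(1,2)[OF M'(1)] \<open>M \<subseteq> P\<close> by auto
  then show False using M' \<open>M \<subseteq> P\<close> by auto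
qed

lemma square_not_below_nonmax_prime:
  assumes "maximalideal M R" "P \<in> nonmax_primes"
  shows "\<not> M \<cdot> M \<subseteq> P"
  using primeideal_divides_ideal_prod[OF nonmax_primesD[OF assms(2)]] maximal_ideal_props(2)[OF assms(1)]
    maximal_not_below_nonmax_prime[OF assms] by blast

end

section \<open>Idempotent factors and inverses modulo a maximal ideal\<close>

context cring
begin

text \<open>The leading idempotent factor \<open>M\<close> absorbs every further copy of
  itself.\<close>

lemma idempotent_prod_filter:
  assumes "ideal M R" "M \<cdot> M = M" "\<And>J. J \<in> set Js \<Longrightarrow> ideal J R"
  shows "M \<cdot> ideal_list_prod R Js = M \<cdot> ideal_list_prod R (filter (\<lambda>J. J \<noteq> M) Js)"
  using assms(3)
proof (induct Js)
  case (Cons A Js)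
  define U where "U = ideal_list_prod R Js"
  define V where "V = ideal_list_prod R (filter (\<lambda>J. J \<noteq> M) Js)"
  have "ideal U R" "ideal V R"
    unfolding U_def V_def by (rule ideal_list_prod_ideal, use Cons.prems in simp)+
  moreover have "ideal A R" using Cons.prems by simp
  ultimately have id: "ideal U R" "ideal V R" "ideal A R" .
  have IH: "M \<cdot> U = M \<cdot> V" using Cons unfolding U_def V_def by simp
  show ?case
  proof (cases "A = M")
    case True
    then have "M \<cdot> (A \<cdot> U) = M \<cdot> U" using ideal_prod_assoc[OF assms(1,1) id(1)] assms(2) by simp
    then show ?thesis using True IH by (simp add: U_def V_def)
  next
    case False
    have "M \<cdot> (A \<cdot> U) = A \<cdot> (M \<cdot> U)" by (rule ideal_prod_left_commute[OF assms(1) id(3,1)])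
    also have "\<dots> = M \<cdot> (A \<cdot> V)"
      unfolding IH by (rule ideal_prod_left_commute[OF id(3) assms(1) id(2)])
    finally show ?thesis using False by (simp add: U_def V_def)
  qed
qed simp

lemma maximal_inverse:
  assumes "maximalideal M R" "n \<in> carrier R - M"
  obtains y where "y \<in> carrier R" "\<one> \<ominus> n \<otimes> y \<in> M"
proof -
  note Mi = maximal_ideal_props(2)[OF assms(1)]
  have nc: "n \<in> carrier R" using assms by simp
  define A where "A = M <+>\<^bsub>R\<^esub> (PIdl n)"
  have Ai: "ideal A R" unfolding A_def by (intro add_ideals Mi cgenideal_ideal nc)
  have Aiff: "z \<in> A \<longleftrightarrow> (\<exists>m\<in>M. \<exists>r\<in>carrier R. z = m \<oplus> n \<otimes> r)" for z
    unfolding A_def sum_ideal_iff using PIdl_iff[OF nc] by metis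
  have "M \<subseteq> A"
  proof
    fix m assume "m \<in> M"
    moreover have "m = m \<oplus> n \<otimes> \<zero>" using nc ideal_carr[OF Mi \<open>m \<in> M\<close>] by simp
    ultimately show "m \<in> A" unfolding Aiff using zero_closed by blast
  qed
  moreover have "n \<in> A"
  proof -
    have "n = \<zero> \<oplus> n \<otimes> \<one>" using nc by simp
    then show ?thesis unfolding Aiff using ideal_zero[OF Mi] one_closed by blast
  qed
  ultimately have "A = carrier R" using maximal_ideal_props(4)[OF assms(1) Ai] assms(2) by blast
  then obtain m y where my: "m \<in> M" "y \<in> carrier R" "\<one> = m \<oplus> n \<otimes> y"
    using Aiff one_closed by blast
  have mc: "m \<in> carrier R" using ideal_carr[OF Mi my(1)] .
  have "\<one> \<ominus> n \<otimes> y = (m \<oplus> n \<otimes> y) \<ominus> n \<otimes> y" using my(3) by simp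
  also have "\<dots> = m" using mc nc my(2) by algebra
  finally show ?thesis using that my by simp
qed

end

section \<open>Rings whose 1-absorbing prime ideals are all prime\<close>

locale prime_principal = OA_principal +
  assumes OA_prime: "\<And>J. OA_ideal J R \<Longrightarrow> primeideal J R"
begin

lemma prime_factorization:
  assumes "x \<in> nonunits R"
  obtains Js where "\<And>J. J \<in> set Js \<Longrightarrow> primeideal J R" "PIdl x = ideal_list_prod R Js"
  using principal_factorization[OF assms] OA_prime by (auto simp: has_OA_factorization_def)

lemma maximal_factorization:
  assumes "x \<in> nonunits R" "\<And>P. P \<in> nonmax_primes \<Longrightarrow> x \<notin> P"
  obtains Js where "\<And>J. J \<in> set Js \<Longrightarrow> maximalideal J R" "PIdl x = ideal_list_prod R Js"
proof -
  obtain Js where Js: "\<And>J. J \<in> set Js \<Longrightarrow> primeideal J R" "PIdl x = ideal_list_prod R Js"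
    using prime_factorization[OF assms(1)] by blast
  have "x \<in> ideal_list_prod R Js"
    using Js(2) cgenideal_self[of x] assms(1) by (simp add: nonunits_def)
  then have "x \<in> J" if "J \<in> set Js" for J
    using ideal_list_prod_subset[of Js J] prime_ideal_props(1)[OF Js(1)] that by blast
  then have "maximalideal J R" if "J \<in> set Js" for J
    using prime_maximal_or_nonmax[OF Js(1)[OF that]] assms(2) that by blast
  then show ?thesis using that Js(2) by blast
qed

text \<open>An element \<open>x\<close> of \<open>M\<close> outside all nonmaximal primes generates
  a product of maximal ideals, one of which is \<open>M\<close>. If the product \<open>N\<close> of
  the others is not inside \<open>M\<close>, any \<open>n\<close> in \<open>N\<close> outside
  \<open>M\<close> multiplies \<open>M\<close> into (x). This holds when \<open>x\<close> is outside
  M^2; if M^2 = \<open>M\<close>, further copies of \<open>M\<close> are absorbed instead.\<close>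

lemma maximal_ideal_locally_principal:
  assumes M: "maximalideal M R"
  obtains x n where "x \<in> M" "\<forall>P\<in>nonmax_primes. x \<notin> P"
    "n \<in> carrier R - M" "\<forall>m\<in>M. n \<otimes> m \<in> PIdl x"
proof -
  note witness = that
  note Mi = maximal_ideal_props(2)[OF M]
  note MMi = ideal_prod_is_ideal[OF Mi Mi]
  have factor: "\<exists>Ks. (\<forall>J\<in>set Ks. maximalideal J R) \<and> PIdl x = M \<cdot> ideal_list_prod R Ks"
    if x: "x \<in> M" "\<And>P. P \<in> nonmax_primes \<Longrightarrow> x \<notin> P" for x
  proof -
    have "x \<in> nonunits R"
      using proper_ideal_subset_nonunits[OF maximal_ideal_props(2,3)[OF M]] x(1) by blast
    then obtain Js where Js: "\<And>J. J \<in> set Js \<Longrightarrow> maximalideal J R" "PIdl x = ideal_list_prod R Js"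
      using maximal_factorization x(2) by blast
    note id = maximal_ideal_props(2)[OF Js(1)]
    have "ideal_list_prod R Js \<subseteq> M" using cgenideal_minimal[OF Mi x(1)] Js(2) by simp
    then obtain J where J: "J \<in> set Js" "J \<subseteq> M"
      using primeideal_divides_ideal_list_prod[OF maximal_ideal_props(1)[OF M], of Js] id by blast
    have "J = M" using maximal_ideal_props(4)[OF Js(1)[OF J(1)] Mi J(2) maximal_ideal_props(3)[OF M]] by simp
    then have "PIdl x = M \<cdot> ideal_list_prod R (remove1 M Js)"
      using ideal_list_prod_remove1[of Js M, OF id] J(1) Js(2) by simp
    moreover have "\<forall>J\<in>set (remove1 M Js). maximalideal J R"
      using Js(1) by (auto dest: notin_set_remove1)
    ultimately show ?thesis by blast
  qed
  have conclude: thesis if g: "x \<in> M" "\<And>P. P \<in> nonmax_primes \<Longrightarrow> x \<notin> P" "PIdl x = M \<cdot> N" "ideal N R"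
    "\<not> N \<subseteq> M" for x N
  proof -
    obtain n where n: "n \<in> N" "n \<notin> M" using g(5) by blast
    have nc: "n \<in> carrier R" using ideal_carr[OF g(4) n(1)] .
    have "n \<otimes> m \<in> PIdl x" if m: "m \<in> M" for m
      using n nc m ideal_carr[OF Mi m] g(3) by (simp add: m_comm ideal_prod.prod)
    then show thesis using witness[of x n] g(1,2) n nc by blast
  qed
  show thesis
  proof (cases "M \<cdot> M = M")
    case False
    then obtain w where w: "w \<in> M" "w \<notin> M \<cdot> M" using ideal_prod_subset_left[OF Mi Mi] by blast
    have wc: "w \<in> carrier R" using ideal_carr[OF Mi w(1)] .
    obtain u where u: "u \<in> M \<cdot> M" "\<And>P. P \<in> nonmax_primes \<Longrightarrow> w \<oplus> u \<notin> P"
      using avoid_nonmax_primes[OF MMi square_not_below_nonmax_prime[OF M] wc] by blast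
    have xM: "w \<oplus> u \<in> M" using ideal_add[OF Mi w(1)] u(1) ideal_prod_subset_left[OF Mi Mi] by blast
    have xMM: "w \<oplus> u \<notin> M \<cdot> M" using ideal_add_cancel_right[OF MMi u(1) wc] w(2) by simp
    obtain Ks where Ks: "\<forall>J\<in>set Ks. maximalideal J R" "PIdl (w \<oplus> u) = M \<cdot> ideal_list_prod R Ks"
      using factor[OF xM u(2)] by blast
    have Ni: "ideal (ideal_list_prod R Ks) R"
      using Ks(1) maximal_ideal_props(2) by (intro ideal_list_prod_ideal) blast
    have "\<not> ideal_list_prod R Ks \<subseteq> M"
    proof
      assume "ideal_list_prod R Ks \<subseteq> M"
      then have "PIdl (w \<oplus> u) \<subseteq> M \<cdot> M" unfolding Ks(2) by (intro ideal_prod_mono) auto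
      then show False using xMM cgenideal_self[OF ideal_carr[OF Mi xM]] by blast
    qed
    then show thesis using conclude[OF xM u(2) Ks(2) Ni] by blast
  next
    case True
    \<comment> \<open>The coset of \<open>\<zero>\<close> gives ordinary prime avoidance.\<close>
    obtain u where u: "u \<in> M" "\<And>P. P \<in> nonmax_primes \<Longrightarrow> \<zero> \<oplus> u \<notin> P"
      using avoid_nonmax_primes[OF Mi maximal_not_below_nonmax_prime[OF M] zero_closed] by blast
    have u2: "\<And>P. P \<in> nonmax_primes \<Longrightarrow> u \<notin> P" using u ideal_carr[OF Mi u(1)] by simp
    obtain Ks where Ks: "\<forall>J\<in>set Ks. maximalideal J R" "PIdl u = M \<cdot> ideal_list_prod R Ks"
      using factor[OF u(1) u2] by blast
    define Ls where "Ls = filter (\<lambda>J. J \<noteq> M) Ks"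
    have id: "ideal J R" if "J \<in> set Ks" for J using Ks(1) maximal_ideal_props(2) that by blast
    have idL: "ideal J R" if "J \<in> set Ls" for J using id that by (simp add: Ls_def)
    have "PIdl u = M \<cdot> ideal_list_prod R Ls"
      using Ks(2) idempotent_prod_filter[OF Mi True, of Ks] id by (simp add: Ls_def)
    moreover have "ideal (ideal_list_prod R Ls) R" using idL by (rule ideal_list_prod_ideal)
    moreover have "\<not> ideal_list_prod R Ls \<subseteq> M"
    proof
      assume "ideal_list_prod R Ls \<subseteq> M"
      then obtain J where J: "J \<in> set Ls" "J \<subseteq> M"
        using primeideal_divides_ideal_list_prod[OF maximal_ideal_props(1)[OF M], of Ls] idL by blast
      then have "maximalideal J R" "J \<noteq> M" using Ks(1) by (auto simp: Ls_def)
      then show False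
        using maximal_ideal_props(4)[OF _ Mi J(2) maximal_ideal_props(3)[OF M]] by blast
    qed
    ultimately show thesis using conclude[OF u(1) u2] by blast
  qed
qed

text \<open>For \<open>a\<close> in \<open>I\<close> write n a = x c with the local generator
  \<open>x\<close>. Then n c lies in the colon ideal, so n^2 a = x (n c) lies in the product. An
  inverse \<open>y\<close> of n^2 modulo \<open>M\<close> splits \<open>a\<close> into y n^2 a and
  (1 - n^2 y) a, and both parts are in the product.\<close>

lemma maximal_ideal_multiplication:
  assumes M: "maximalideal M R" and I: "ideal I R" "I \<subseteq> M"
  shows "I = M \<cdot> {z \<in> carrier R. \<forall>m\<in>M. z \<otimes> m \<in> I}" (is "I = M \<cdot> ?C")
proof
  note Mi = maximal_ideal_props(2)[OF M]
  have Ci: "ideal ?C R" by (rule ideal_colon[OF I(1) ideal_subset_carrier[OF Mi]])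
  show "M \<cdot> ?C \<subseteq> I"
  proof (rule ideal_prod_subsetI[OF I(1)])
    fix m z assume "m \<in> M" "z \<in> ?C"
    then show "m \<otimes> z \<in> I" using ideal_carr[OF Mi] m_comm by auto
  qed
  show "I \<subseteq> M \<cdot> ?C"
  proof
    fix a assume a: "a \<in> I"
    have ac: "a \<in> carrier R" and aM: "a \<in> M" using ideal_carr[OF I(1) a] a I(2) by auto
    obtain x n where xn: "x \<in> M" "\<forall>P\<in>nonmax_primes. x \<notin> P"
      "n \<in> carrier R - M" "\<forall>m\<in>M. n \<otimes> m \<in> PIdl x"
      by (rule maximal_ideal_locally_principal[OF M])
    have xc: "x \<in> carrier R" and nc: "n \<in> carrier R" using ideal_carr[OF Mi xn(1)] xn(3) by auto
    obtain c where c: "c \<in> carrier R" "n \<otimes> a = x \<otimes> c" using bspec[OF xn(4) aM] PIdl_iff[OF xc] by blast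
    have "n \<otimes> c \<in> ?C"
    proof -
      have "(n \<otimes> c) \<otimes> m \<in> I" if m: "m \<in> M" for m
      proof -
        have mc: "m \<in> carrier R" using ideal_carr[OF Mi m] .
        obtain r where r: "r \<in> carrier R" "n \<otimes> m = x \<otimes> r" using bspec[OF xn(4) m] PIdl_iff[OF xc] by blast
        have "(n \<otimes> c) \<otimes> m = c \<otimes> (n \<otimes> m)" using nc c(1) mc by algebra
        also have "\<dots> = (x \<otimes> c) \<otimes> r" unfolding r(2) using xc c(1) r(1) by algebra
        also have "\<dots> = a \<otimes> (n \<otimes> r)" unfolding c(2)[symmetric] using ac nc r(1) by algebra
        finally show ?thesis using ideal_mult_right[OF I(1) a] nc r(1) by simp
      qed
      then show ?thesis using nc c by simp
    qed
    then have 1: "x \<otimes> (n \<otimes> c) \<in> M \<cdot> ?C" using xn(1) by (simp add: ideal_prod.prod)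
    have "n \<otimes> n \<in> carrier R - M" using nc xn(3) prime_ideal_props(4)[OF maximal_ideal_props(1)[OF M]] by simp
    then obtain y where y: "y \<in> carrier R" "\<one> \<ominus> (n \<otimes> n) \<otimes> y \<in> M" using maximal_inverse[OF M] by blast
    have "a \<in> ?C" using ac ideal_mult_right[OF I(1) a] ideal_carr[OF Mi] by simp
    then have 2: "(\<one> \<ominus> (n \<otimes> n) \<otimes> y) \<otimes> a \<in> M \<cdot> ?C" using y(2) by (rule ideal_prod.prod[rotated])
    have "a = ((n \<otimes> y) \<otimes> (n \<otimes> a)) \<oplus> (\<one> \<ominus> (n \<otimes> n) \<otimes> y) \<otimes> a" using ac nc y(1) by algebra
    also have "(n \<otimes> y) \<otimes> (n \<otimes> a) = y \<otimes> (x \<otimes> (n \<otimes> c))"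
      unfolding c(2) using nc y(1) xc c(1) by algebra
    finally show "a \<in> M \<cdot> ?C"
      using ideal_add[OF ideal_prod_is_ideal[OF Mi Ci] ideal_mult_left[OF ideal_prod_is_ideal[OF Mi Ci] 1 y(1)] 2]
      by simp
  qed
qed

text \<open>It suffices that the annihilator \<open>A\<close> of \<open>p\<close> and
  \<open>P\<close> are comaximal: writing \<open>\<one>\<close> as \<open>s \<oplus> q\<close> gives
  the required \<open>q\<close>. If both were in a maximal ideal \<open>M\<close> with local
  generator \<open>x\<close>, then \<open>n\<close> would multiply \<open>P\<close> into x P,
  because \<open>x\<close> is outside \<open>P\<close>. From (p) = \<open>P \<cdot> K\<close>
  follows n p = a p with \<open>a\<close> in (x), so n - a is in \<open>A\<close>, hence in
  \<open>M\<close>, and \<open>n\<close> would be in \<open>M\<close>.\<close>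

lemma nonmax_prime_pure:
  assumes P: "P \<in> nonmax_primes" and p: "p \<in> P"
  obtains q where "q \<in> P" "p = p \<otimes> q"
proof -
  note Pp = nonmax_primesD[OF P]
  note Pi = prime_ideal_props(1)[OF Pp]
  have pc: "p \<in> carrier R" using ideal_carr[OF Pi p] .
  define A where "A = {z \<in> carrier R. \<forall>b\<in>{p}. z \<otimes> b \<in> {\<zero>}}"
  have Ai: "ideal A R" unfolding A_def by (rule ideal_colon[OF zeroideal]) (use pc in simp)
  have Aiff: "z \<in> A \<longleftrightarrow> z \<in> carrier R \<and> z \<otimes> p = \<zero>" for z by (simp add: A_def)
  define B where "B = A <+>\<^bsub>R\<^esub> P"
  have Bi: "ideal B R" unfolding B_def by (rule add_ideals[OF Ai Pi])
  have "B = carrier R"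
  proof (rule ccontr)
    assume "B \<noteq> carrier R"
    then obtain M where M: "maximalideal M R" "B \<subseteq> M" using exists_maximalideal[OF Bi] by blast
    note Mi = maximal_ideal_props(2)[OF M(1)]
    have AM: "z \<in> M" if z: "z \<in> A" for z
    proof -
      have "z = z \<oplus> \<zero>" using ideal_carr[OF Ai z] by simp
      then have "z \<in> B" unfolding B_def sum_ideal_iff using z ideal_zero[OF Pi] by blast
      then show ?thesis using M by blast
    qed
    have PM: "z \<in> M" if z: "z \<in> P" for z
    proof -
      have "z = \<zero> \<oplus> z" using ideal_carr[OF Pi z] by simp
      then have "z \<in> B" unfolding B_def sum_ideal_iff using z ideal_zero[OF Ai] by blast
      then show ?thesis using M by blast
    qed
    obtain x n where xn: "x \<in> M" "\<forall>P\<in>nonmax_primes. x \<notin> P"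
      "n \<in> carrier R - M" "\<forall>m\<in>M. n \<otimes> m \<in> PIdl x"
      by (rule maximal_ideal_locally_principal[OF M(1)])
    have xc: "x \<in> carrier R" and nc: "n \<in> carrier R" using ideal_carr[OF Mi xn(1)] xn(3) by auto
    obtain K where K: "ideal K R" "PIdl p = P \<cdot> K" using nonmax_prime_divides[OF P p] by blast
    define D where "D = (PIdl x) \<cdot> (PIdl p)"
    have Di: "ideal D R" unfolding D_def by (intro ideal_prod_is_ideal cgenideal_ideal xc pc)
    have "P \<cdot> K \<subseteq> {z \<in> carrier R. \<forall>b\<in>{n}. z \<otimes> b \<in> D}"
    proof (rule ideal_prod_subsetI)
      show "ideal {z \<in> carrier R. \<forall>b\<in>{n}. z \<otimes> b \<in> D} R"
        by (rule ideal_colon[OF Di]) (use nc in simp)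
      fix y k assume yk: "y \<in> P" "k \<in> K"
      have c: "y \<in> carrier R" "k \<in> carrier R" using ideal_carr[OF Pi] ideal_carr[OF K(1)] yk by auto
      obtain e where e: "e \<in> carrier R" "n \<otimes> y = x \<otimes> e" using bspec[OF xn(4) PM[OF yk(1)]] PIdl_iff[OF xc] by blast
      have "x \<otimes> e \<in> P" using e(2) ideal_mult_left[OF Pi yk(1) nc] by simp
      then have "e \<in> P" using prime_ideal_props(4)[OF Pp xc e(1)] xn(2) P by simp
      then have "e \<otimes> k \<in> PIdl p" using yk K(2) by (simp add: ideal_prod.prod)
      then have "x \<otimes> (e \<otimes> k) \<in> D"
        unfolding D_def using cgenideal_self[OF xc] by (rule ideal_prod.prod[rotated])
      moreover have "(y \<otimes> k) \<otimes> n = (n \<otimes> y) \<otimes> k" using c nc by algebra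
      then have "(y \<otimes> k) \<otimes> n = x \<otimes> (e \<otimes> k)" using e xc c by (simp add: m_assoc)
      ultimately show "y \<otimes> k \<in> {z \<in> carrier R. \<forall>b\<in>{n}. z \<otimes> b \<in> D}" using c by simp
    qed
    then have "p \<otimes> n \<in> D" using K(2) cgenideal_self[OF pc] by blast
    then obtain a where a: "a \<in> PIdl x" "p \<otimes> n = a \<otimes> p"
      unfolding D_def using prod_PIdl_iff[OF cgenideal_ideal[OF xc] pc] by blast
    have aM: "a \<in> M" using a(1) cgenideal_minimal[OF Mi xn(1)] by blast
    have ac: "a \<in> carrier R" using ideal_carr[OF Mi aM] .
    have "(n \<ominus> a) \<otimes> p = p \<otimes> n \<ominus> a \<otimes> p" using nc ac pc by algebra
    also have "\<dots> = a \<otimes> p \<ominus> a \<otimes> p" using a(2) by simp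
    also have "\<dots> = \<zero>" using ac pc by algebra
    finally have "n \<ominus> a \<in> A" using nc ac by (simp add: Aiff)
    then have "n \<in> M" using ideal_minusD[OF Mi AM aM nc] by simp
    then show False using xn(3) by simp
  qed
  then obtain s q where sq: "s \<in> A" "q \<in> P" "\<one> = s \<oplus> q"
    using one_closed unfolding B_def by (metis sum_ideal_iff)
  have c: "s \<in> carrier R" "q \<in> carrier R" "s \<otimes> p = \<zero>" using sq Aiff ideal_carr[OF Pi] by auto
  have "p = (s \<oplus> q) \<otimes> p" using sq(3) pc by (metis l_one)
  also have "\<dots> = q \<otimes> p" using c pc by (simp add: l_distr)
  also have "\<dots> = p \<otimes> q" using c pc by (simp add: m_comm)
  finally show thesis using that sq(2) by blast
qed

text \<open>Purity makes \<open>P\<close> idempotent, so in a factorization of the zero ideal the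
  repeated copies of \<open>P\<close> merge into one. The other prime factors are not below the
  minimal prime \<open>P\<close>, hence their product contains some \<open>k\<close> outside
  \<open>P\<close>, and \<open>k\<close> kills \<open>P\<close>.\<close>

lemma nonmax_prime_annihilator:
  assumes P: "P \<in> nonmax_primes"
  obtains k where "k \<in> carrier R - P" "\<And>p. p \<in> P \<Longrightarrow> k \<otimes> p = \<zero>"
proof -
  note Pp = nonmax_primesD[OF P]
  note Pi = prime_ideal_props(1)[OF Pp]
  have PP: "P \<cdot> P = P"
  proof
    show "P \<cdot> P \<subseteq> P" by (rule ideal_prod_subset_left[OF Pi Pi])
    show "P \<subseteq> P \<cdot> P"
    proof
      fix p assume p: "p \<in> P"
      obtain q where "q \<in> P" "p = p \<otimes> q" using nonmax_prime_pure[OF P p] by blast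
      then show "p \<in> P \<cdot> P" using ideal_prod.prod[OF p, of q P R] by simp
    qed
  qed
  obtain Js where Js: "\<And>J. J \<in> set Js \<Longrightarrow> primeideal J R" "PIdl \<zero> = ideal_list_prod R Js"
    using prime_factorization[OF zero_nonunit] by blast
  note id = prime_ideal_props(1)[OF Js(1)]
  have "ideal_list_prod R Js \<subseteq> P"
    unfolding Js(2)[symmetric] PIdl_zero using ideal_zero[OF Pi] by simp
  then have "P \<in> set Js" using nonmax_prime_in_factorization[OF P] prime_imp_OA[OF Js(1)] by blast
  then have 0: "{\<zero>} = P \<cdot> ideal_list_prod R (remove1 P Js)"
    using ideal_list_prod_remove1[of Js P, OF id] Js(2) PIdl_zero by simp
  define Ls where "Ls = filter (\<lambda>J. J \<noteq> P) (remove1 P Js)"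
  have prL: "primeideal J R \<and> J \<noteq> P" if "J \<in> set Ls" for J
    using Js(1) that notin_set_remove1[of J Js P] by (auto simp: Ls_def)
  have Li: "ideal (ideal_list_prod R Ls) R"
    by (rule ideal_list_prod_ideal) (use prL prime_ideal_props(1) in blast)
  have "ideal J R" if "J \<in> set (remove1 P Js)" for J using id that notin_set_remove1[of J Js P] by blast
  then have 1: "{\<zero>} = P \<cdot> ideal_list_prod R Ls"
    using 0 idempotent_prod_filter[OF Pi PP, of "remove1 P Js"] by (simp add: Ls_def)
  have "\<not> ideal_list_prod R Ls \<subseteq> P"
  proof
    assume "ideal_list_prod R Ls \<subseteq> P"
    then have "P \<in> set Ls" using nonmax_prime_in_factorization[OF P] prime_imp_OA prL by blast
    then show False using prL by blast
  qed
  then obtain k where k: "k \<in> ideal_list_prod R Ls" "k \<notin> P" by blast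
  have kc: "k \<in> carrier R" using ideal_carr[OF Li k(1)] .
  have "k \<otimes> p = \<zero>" if p: "p \<in> P" for p
  proof -
    have "p \<otimes> k \<in> {\<zero>}" unfolding 1 using p k(1) by (rule ideal_prod.prod)
    then show ?thesis using kc ideal_carr[OF Pi p] by (simp add: m_comm)
  qed
  then show thesis using that kc k(2) by blast
qed

text \<open>Induction on the number of maximal factors. A maximal ideal \<open>M\<close> above
  \<open>I\<close> occurs among them, and I = M (I : M), where the colon ideal contains the product
  with one copy of \<open>M\<close> removed. The empty list stands for the unit ideal, where the
  process stops.\<close>

lemma factorization_over_maximal_product:
  assumes "\<And>J. J \<in> set Js \<Longrightarrow> maximalideal J R" "ideal I R" "ideal_list_prod R Js \<subseteq> I"
  shows "\<exists>Ps. (\<forall>P\<in>set Ps. primeideal P R) \<and> I = ideal_list_prod R Ps"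
  using assms
proof (induct "length Js" arbitrary: Js I rule: less_induct)
  case less
  show ?case
  proof (cases "I = carrier R")
    case True
    then show ?thesis by (intro exI[of _ "[]"]) simp
  next
    case False
    then obtain M where M: "maximalideal M R" "I \<subseteq> M" using exists_maximalideal[OF less.prems(2)] by blast
    note Mi = maximal_ideal_props(2)[OF M(1)]
    note id = maximal_ideal_props(2)[OF less.prems(1)]
    obtain J where J: "J \<in> set Js" "J \<subseteq> M"
      using primeideal_divides_ideal_list_prod[OF maximal_ideal_props(1)[OF M(1)], of Js] id less.prems(3) M(2) by blast
    have "J = M"
      using maximal_ideal_props(4)[OF less.prems(1)[OF J(1)] Mi J(2) maximal_ideal_props(3)[OF M(1)]] by simp
    then have MJs: "M \<in> set Js" using J by simp
    define C where "C = {z \<in> carrier R. \<forall>m\<in>M. z \<otimes> m \<in> I}"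
    have Ci: "ideal C R"
      unfolding C_def by (rule ideal_colon[OF less.prems(2) ideal_subset_carrier[OF Mi]])
    have IMC: "I = M \<cdot> C" unfolding C_def by (rule maximal_ideal_multiplication[OF M(1) less.prems(2) M(2)])
    have max': "maximalideal J R" if "J \<in> set (remove1 M Js)" for J
      using less.prems(1) that notin_set_remove1[of J Js M] by blast
    have Ki: "ideal (ideal_list_prod R (remove1 M Js)) R"
      by (rule ideal_list_prod_ideal) (use max' maximal_ideal_props(2) in blast)
    have "ideal_list_prod R (remove1 M Js) \<subseteq> C"
    proof
      fix z assume z: "z \<in> ideal_list_prod R (remove1 M Js)"
      have zc: "z \<in> carrier R" using ideal_carr[OF Ki z] .
      have "z \<otimes> m \<in> I" if m: "m \<in> M" for m
      proof -
        have "m \<otimes> z \<in> ideal_list_prod R Js"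
          using ideal_list_prod_remove1[of Js M, OF id MJs] m z by (simp add: ideal_prod.prod)
        then show ?thesis using less.prems(3) zc ideal_carr[OF Mi m] m_comm[of m z] by auto
      qed
      then show "z \<in> C" using zc by (simp add: C_def)
    qed
    moreover have "length (remove1 M Js) < length Js" using MJs by (metis length_remove1 length_pos_if_in_set diff_less zero_less_one)
    ultimately obtain Ps where Ps: "\<forall>P\<in>set Ps. primeideal P R" "C = ideal_list_prod R Ps"
      using less.hyps[of "remove1 M Js" C] max' Ci by blast
    have "I = ideal_list_prod R (M # Ps)" using IMC Ps(2) by simp
    moreover have "\<forall>P\<in>set (M # Ps). primeideal P R" using Ps(1) maximal_ideal_props(1)[OF M(1)] by simp
    ultimately show ?thesis by blast
  qed
qed

text \<open>Induction on the number of nonmaximal primes above \<open>I\<close>. If there are none,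
  prime avoidance finds an element of \<open>I\<close> whose principal ideal is a product of maximal
  ideals, unless it is a unit. Otherwise purity gives I = P (I : P), and the annihilator of
  \<open>P\<close> lies in the colon ideal but not in \<open>P\<close>, so the number drops.\<close>

lemma prime_ideal_factorization:
  assumes "ideal I R"
  shows "\<exists>Ps. (\<forall>P\<in>set Ps. primeideal P R) \<and> I = ideal_list_prod R Ps"
  using assms
proof (induct "card {P \<in> nonmax_primes. I \<subseteq> P}" arbitrary: I rule: less_induct)
  case less
  show ?case
  proof (cases "\<exists>P\<in>nonmax_primes. I \<subseteq> P")
    case False
    then obtain a where a: "a \<in> I" "\<And>P. P \<in> nonmax_primes \<Longrightarrow> \<zero> \<oplus> a \<notin> P"
      using avoid_nonmax_primes[OF less.prems _ zero_closed] by blast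
    have ac: "a \<in> carrier R" using ideal_carr[OF less.prems a(1)] .
    show ?thesis
    proof (cases "a \<in> nonunits R")
      case True
      then obtain Js where Js: "\<And>J. J \<in> set Js \<Longrightarrow> maximalideal J R" "PIdl a = ideal_list_prod R Js"
        using maximal_factorization[OF True] a(2) ac by auto
      have "ideal_list_prod R Js \<subseteq> I" using cgenideal_minimal[OF less.prems a(1)] Js(2) by simp
      then show ?thesis using factorization_over_maximal_product[OF Js(1) less.prems] by blast
    next
      case False
      then have "I = carrier R"
        using proper_ideal_subset_nonunits[OF less.prems] a(1) by blast
      then show ?thesis by (intro exI[of _ "[]"]) simp
    qed
  next
    case True
    then obtain P where P: "P \<in> nonmax_primes" "I \<subseteq> P" by blast
    note Pp = nonmax_primesD[OF P(1)]
    note Pi = prime_ideal_props(1)[OF Pp]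
    define C where "C = {z \<in> carrier R. \<forall>p\<in>P. z \<otimes> p \<in> I}"
    have Ci: "ideal C R" unfolding C_def by (rule ideal_colon[OF less.prems ideal_subset_carrier[OF Pi]])
    have IC: "I \<subseteq> C"
    proof
      fix a assume a: "a \<in> I"
      then show "a \<in> C"
        using ideal_carr[OF less.prems a] ideal_mult_right[OF less.prems a] ideal_carr[OF Pi] by (simp add: C_def)
    qed
    have IPC: "I = P \<cdot> C"
    proof
      show "P \<cdot> C \<subseteq> I"
      proof (rule ideal_prod_subsetI[OF less.prems])
        fix p z assume "p \<in> P" "z \<in> C"
        then show "p \<otimes> z \<in> I" using ideal_carr[OF Pi] m_comm by (auto simp: C_def)
      qed
      show "I \<subseteq> P \<cdot> C"
      proof
        fix a assume a: "a \<in> I"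
        then obtain q where q: "q \<in> P" "a = a \<otimes> q" using nonmax_prime_pure[OF P(1)] P(2) by blast
        then have "a = q \<otimes> a" using ideal_carr[OF Pi q(1)] ideal_carr[OF less.prems a] m_comm by simp
        moreover have "q \<otimes> a \<in> P \<cdot> C" using q(1) a IC by (intro ideal_prod.prod) auto
        ultimately show "a \<in> P \<cdot> C" by simp
      qed
    qed
    obtain k where k: "k \<in> carrier R - P" "\<And>p. p \<in> P \<Longrightarrow> k \<otimes> p = \<zero>"
      using nonmax_prime_annihilator[OF P(1)] by blast
    have "k \<in> C" using k ideal_zero[OF less.prems] by (simp add: C_def)
    then have "\<not> C \<subseteq> P" using k by blast
    then have "{Q \<in> nonmax_primes. C \<subseteq> Q} \<subset> {Q \<in> nonmax_primes. I \<subseteq> Q}" using IC P by blast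
    then have "card {Q \<in> nonmax_primes. C \<subseteq> Q} < card {Q \<in> nonmax_primes. I \<subseteq> Q}"
      by (intro psubset_card_mono) (simp add: finite_nonmax_primes)
    then obtain Ps where Ps: "\<forall>P\<in>set Ps. primeideal P R" "C = ideal_list_prod R Ps"
      using less.hyps[OF _ Ci] by blast
    have "I = ideal_list_prod R (P # Ps)" using IPC Ps(2) by simp
    moreover have "\<forall>Q\<in>set (P # Ps). primeideal Q R" using Ps(1) Pp by simp
    ultimately show ?thesis by blast
  qed
qed

theorem general_ZPI: "general_ZPI_ring R"
  unfolding general_ZPI_ring_def
proof (intro conjI allI impI)
  fix I assume I: "proper_ideal I R"
  then obtain Ps where Ps: "\<forall>P\<in>set Ps. primeideal P R" "I = ideal_list_prod R Ps"
    using prime_ideal_factorization by (auto simp: proper_ideal_def)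
  moreover have "Ps \<noteq> []" using I Ps(2) by (auto simp: proper_ideal_def)
  ultimately show "\<exists>Ps. Ps \<noteq> [] \<and> (\<forall>P\<in>set Ps. primeideal P R) \<and> I = ideal_list_prod R Ps" by blast
qed (rule is_cring)

end

section \<open>Local rings\<close>

context cring
begin

lemma ideals_set_mult [simp]: "I \<otimes>\<^bsub>ideals_set R\<^esub> J = I \<cdot> J"
  by (simp add: ideals_set_def)

lemma ideals_set_one [simp]: "\<one>\<^bsub>ideals_set R\<^esub> = carrier R"
  by (simp add: ideals_set_def)

lemma ideal_power_Suc: "ideal_power R I (Suc n) = ideal_power R I n \<cdot> I"
  by simp

lemma ideal_power_ideal: "ideal I R \<Longrightarrow> ideal (ideal_power R I n) R"
  by (induct n) (simp_all add: oneideal ideal_prod_is_ideal)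

lemma ideal_power_1: "ideal I R \<Longrightarrow> ideal_power R I (Suc 0) = I"
  by (simp add: carrier_prod_ideal)

lemma ideal_power_2: "ideal I R \<Longrightarrow> ideal_power R I 2 = I \<cdot> I"
  by (simp add: numeral_2_eq_2 carrier_prod_ideal)

lemma nonunit_iff_in_maximal:
  assumes "a \<in> carrier R"
  shows "a \<in> nonunits R \<longleftrightarrow> (\<exists>m. maximalideal m R \<and> a \<in> m)"
proof
  assume "a \<in> nonunits R"
  then show "\<exists>m. maximalideal m R \<and> a \<in> m" by (rule exists_maximal_over_nonunit)
next
  assume "\<exists>m. maximalideal m R \<and> a \<in> m"
  then obtain m where m: "maximalideal m R" "a \<in> m" by blast
  then show "a \<in> nonunits R"
    using proper_ideal_subset_nonunits[OF maximal_ideal_props(2,3)[OF m(1)]] by blast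
qed

lemma nonunits_ne_carrier: "nonunits R \<noteq> carrier R"
proof
  assume "nonunits R = carrier R"
  then have "\<one> \<in> nonunits R" by simp
  then show False by (simp add: nonunits_def)
qed

lemma maximal_eq_nonunits:
  assumes "ideal (nonunits R) R"
  shows "maximalideal m R \<longleftrightarrow> m = nonunits R"
proof
  assume m: "maximalideal m R"
  have "m \<subseteq> nonunits R" by (rule proper_ideal_subset_nonunits[OF maximal_ideal_props(2,3)[OF m]])
  then show "m = nonunits R"
    using maximal_ideal_props(4)[OF m assms _ nonunits_ne_carrier] by simp
next
  assume m: "m = nonunits R"
  obtain m' where m': "maximalideal m' R" "nonunits R \<subseteq> m'"
    using exists_maximalideal[OF assms nonunits_ne_carrier] by blast
  have "m' \<subseteq> nonunits R" by (rule proper_ideal_subset_nonunits[OF maximal_ideal_props(2,3)[OF m'(1)]])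
  then show "maximalideal m R" using m m' by simp
qed

lemma local_ring_iff: "local_ring R \<longleftrightarrow> ideal (nonunits R) R"
proof
  assume "local_ring R"
  then have "\<exists>!m. maximalideal m R" by (simp add: local_ring_def)
  then obtain m where m: "maximalideal m R" "\<And>m'. maximalideal m' R \<Longrightarrow> m' = m" by (elim ex1E) blast
  have "a \<in> nonunits R \<longleftrightarrow> a \<in> m" if "a \<in> carrier R" for a
    using nonunit_iff_in_maximal[OF that] m by metis
  moreover have "m \<subseteq> carrier R" by (rule ideal_subset_carrier[OF maximal_ideal_props(2)[OF m(1)]])
  moreover have "nonunits R \<subseteq> carrier R" by (auto simp: nonunits_def)
  ultimately have "nonunits R = m" by blast
  then show "ideal (nonunits R) R" using maximal_ideal_props(2)[OF m(1)] by simp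
next
  assume "ideal (nonunits R) R"
  then show "local_ring R" using maximal_eq_nonunits by (auto simp: local_ring_def is_cring)
qed

lemma jacobson_radical_local:
  assumes "ideal (nonunits R) R"
  shows "jacobson_radical R = nonunits R"
proof -
  have "{m. maximalideal m R} = {nonunits R}" using maximal_eq_nonunits[OF assms] by auto
  then show ?thesis by (auto simp: jacobson_radical_def nonunits_def)
qed

text \<open>The point is closure under addition. If a + b were a unit for nonunits \<open>a\<close>,
  \<open>b\<close>, then (a + b) a and (a + b) b would lie in \<open>J\<close>, as \<open>J\<close>
  absorbs products of nonunits; cancelling the unit puts \<open>a\<close>, \<open>b\<close> and then
  a + b into \<open>J\<close>.\<close>

lemma nonprime_OA_imp_local:
  assumes "OA_ideal J R" "\<not> primeideal J R"
  shows "ideal (nonunits R) R"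
proof (rule ideal_criterion)
  note Ji = OA_ideal_proper(1)[OF assms(1)]
  note JN = OA_ideal_proper(3)[OF assms(1)]
  show "nonunits R \<subseteq> carrier R" by (auto simp: nonunits_def)
  show "\<zero> \<in> nonunits R" using ideal_zero[OF Ji] JN by blast
  show "x \<otimes> a \<in> nonunits R" if "a \<in> nonunits R" "x \<in> carrier R" for a x
  proof -
    obtain m where m: "maximalideal m R" "a \<in> m" using exists_maximal_over_nonunit[OF \<open>a \<in> nonunits R\<close>] by blast
    have "x \<otimes> a \<in> m" using ideal_mult_left[OF maximal_ideal_props(2)[OF m(1)] m(2)] that by simp
    then show ?thesis
      using proper_ideal_subset_nonunits[OF maximal_ideal_props(2,3)[OF m(1)]] by blast
  qed
  show "a \<oplus> b \<in> nonunits R" if ab: "a \<in> nonunits R" "b \<in> nonunits R" for a b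
  proof (rule ccontr)
    assume "a \<oplus> b \<notin> nonunits R"
    have c: "a \<in> carrier R" "b \<in> carrier R" using ab by (auto simp: nonunits_def)
    then have u: "a \<oplus> b \<in> Units R" using \<open>a \<oplus> b \<notin> nonunits R\<close> by (simp add: nonunits_def)
    have "a \<otimes> a \<in> J" "b \<otimes> a \<in> J" "a \<otimes> b \<in> J" "b \<otimes> b \<in> J"
      using OA_nonprime_absorbs[OF assms] ab by auto
    then have "(a \<oplus> b) \<otimes> a \<in> J" "(a \<oplus> b) \<otimes> b \<in> J"
      using c ideal_add[OF Ji] by (simp_all add: l_distr)
    then have "a \<in> J" "b \<in> J" using ideal_cancel_unit[OF Ji u] c by auto
    then have "a \<oplus> b \<in> J" by (rule ideal_add[OF Ji])
    then show False using JN \<open>a \<oplus> b \<notin> nonunits R\<close> by blast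
  qed
qed

end

section \<open>Local rings whose squared maximal ideal is divided\<close>

locale local_cring = cring +
  fixes M
  assumes M_def: "M = nonunits R" and M_ideal: "ideal M R"
begin

lemma M_nonunits: "nonunits R = M" by (simp add: M_def)

lemma unit_iff: "a \<in> carrier R \<Longrightarrow> a \<in> Units R \<longleftrightarrow> a \<notin> M"
  by (simp add: M_def nonunits_def)

lemma M_maximal: "maximalideal M R"
  using maximal_eq_nonunits M_ideal by (simp add: M_def)

lemma proper_subset_M: "\<lbrakk>ideal I R; I \<noteq> carrier R\<rbrakk> \<Longrightarrow> I \<subseteq> M"
  unfolding M_def by (rule proper_ideal_subset_nonunits)

lemma one_minus_unit:
  assumes "m \<in> M"
  shows "\<one> \<ominus> m \<in> Units R"
proof -
  have mc: "m \<in> carrier R" using ideal_carr[OF M_ideal assms] .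
  have "\<one> \<ominus> m \<notin> M"
    using ideal_minusD[OF M_ideal _ assms one_closed] prime_ideal_props(3)[OF maximal_ideal_props(1)[OF M_maximal]]
    by blast
  then show ?thesis using unit_iff mc by simp
qed

text \<open>Here x = m x with \<open>m\<close> in \<open>M\<close>, and 1 - m is a unit.\<close>

lemma nakayama:
  assumes "x \<in> carrier R" "x \<in> M \<cdot> (PIdl x)"
  shows "x = \<zero>"
proof -
  obtain m where m: "m \<in> M" "x = m \<otimes> x" using prod_PIdl_iff[OF M_ideal assms(1)] assms(2) by blast
  have mc: "m \<in> carrier R" using ideal_carr[OF M_ideal m(1)] .
  have "(\<one> \<ominus> m) \<otimes> x = x \<ominus> m \<otimes> x" using mc assms(1) by algebra
  also have "\<dots> = x \<ominus> x" using m(2) by simp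
  also have "\<dots> = \<zero>" using assms(1) by (simp add: r_neg a_minus_def)
  finally have "x \<in> {\<zero>}" using ideal_cancel_unit[OF zeroideal one_minus_unit[OF m(1)] assms(1)] by simp
  then show ?thesis by simp
qed

lemma OA_if_contains_square:
  assumes "ideal I R" "I \<noteq> carrier R" "M \<cdot> M \<subseteq> I"
  shows "OA_ideal I R"
  unfolding OA_ideal_def proper_ideal_def M_nonunits
  using assms by (auto intro: ideal_prod.prod)

lemma OA_square_cases:
  assumes "OA_ideal J R"
  shows "primeideal J R \<or> M \<cdot> M \<subseteq> J"
  using OA_nonprime_absorbs[OF assms] ideal_prod_subsetI[OF OA_ideal_proper(1)[OF assms], of M M]
  unfolding M_nonunits by blast

text \<open>Write an element of M^2 as y r. A unit \<open>r\<close> would put \<open>y\<close> into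
  M^2, so \<open>r\<close> is in \<open>M\<close>.\<close>

lemma square_generated:
  assumes "M \<cdot> M \<subseteq> PIdl y" "y \<in> M" "y \<notin> M \<cdot> M"
  shows "M \<cdot> M = M \<cdot> (PIdl y)"
proof
  note MMi = ideal_prod_is_ideal[OF M_ideal M_ideal]
  have yc: "y \<in> carrier R" using ideal_carr[OF M_ideal assms(2)] .
  show "M \<cdot> M \<subseteq> M \<cdot> (PIdl y)"
  proof
    fix z assume z: "z \<in> M \<cdot> M"
    then obtain r where r: "r \<in> carrier R" "z = y \<otimes> r" using assms(1) PIdl_iff[OF yc] by blast
    have "r \<in> M"
    proof (rule ccontr)
      assume "r \<notin> M"
      then have "r \<in> Units R" using unit_iff r by simp
      moreover have "r \<otimes> y \<in> M \<cdot> M" using z r yc by (simp add: m_comm)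
      ultimately show False using ideal_cancel_unit[OF MMi _ yc] assms(3) by blast
    qed
    moreover have "z = r \<otimes> y" using r yc by (simp add: m_comm)
    ultimately show "z \<in> M \<cdot> (PIdl y)" using prod_PIdl_iff[OF M_ideal yc] by blast
  qed
  show "M \<cdot> (PIdl y) \<subseteq> M \<cdot> M"
    using cgenideal_minimal[OF M_ideal assms(2)] by (intro ideal_prod_mono) auto
qed

lemma power_subset_list_prod:
  assumes "\<And>J. J \<in> set Js \<Longrightarrow> ideal J R \<and> M \<cdot> M \<subseteq> J"
  shows "ideal_power R M (2 * length Js) \<subseteq> ideal_list_prod R Js"
  using assms
proof (induct Js)
  case (Cons J Js)
  let ?P = "ideal_power R M (2 * length Js)"
  note Pi = ideal_power_ideal[OF M_ideal, of "2 * length Js"]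
  have "ideal_power R M (2 * length (J # Js)) = (?P \<cdot> M) \<cdot> M" by (simp add: ideal_power_Suc)
  also have "\<dots> = (M \<cdot> M) \<cdot> ?P"
    using ideal_prod_assoc[OF Pi M_ideal M_ideal]
      ideal_prod_commute[OF Pi ideal_prod_is_ideal[OF M_ideal M_ideal]] by simp
  also have "\<dots> \<subseteq> J \<cdot> ideal_list_prod R Js" using Cons by (intro ideal_prod_mono) auto
  finally show ?case by simp
qed (simp add: carrier_prod_ideal)

text \<open>Induction on the order of \<open>I\<close> with respect to powers of \<open>M\<close>,
  where \<open>n = 0\<close> means order one. In that case \<open>I\<close> is not inside M^2, so it
  contains M^2 and is itself 1-absorbing prime. Otherwise M^2 = M (x) lets a factor (x) be split
  off, which lowers the order by one.\<close>

lemma divided_square_factorization: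
  assumes divided: "divided_ideal (M \<cdot> M) R" and x: "x \<in> M" "x \<notin> M \<cdot> M"
  shows "\<lbrakk>ideal I R; I \<subseteq> ideal_power R M (Suc n); \<not> I \<subseteq> ideal_power R M (Suc (Suc n))\<rbrakk>
    \<Longrightarrow> has_OA_factorization I R"
proof (induct n arbitrary: I)
  case 0
  have "I \<subseteq> M" "\<not> I \<subseteq> M \<cdot> M" using 0 M_ideal by (simp_all add: carrier_prod_ideal)
  then have "M \<cdot> M \<subseteq> I" using divided 0(1) by (auto simp: divided_ideal_def)
  moreover have "I \<noteq> carrier R" using \<open>I \<subseteq> M\<close> maximal_ideal_props(3)[OF M_maximal] ideal_subset_carrier[OF M_ideal] by blast
  ultimately have "OA_ideal I R" using OA_if_contains_square 0(1) by blast
  then show ?case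
    unfolding has_OA_factorization_def using ideal_list_prod_single[OF 0(1)]
    by (intro exI[of _ "[I]"]) simp
next
  case (Suc n)
  note Mi = M_ideal
  have xc: "x \<in> carrier R" using ideal_carr[OF Mi x(1)] .
  have xi: "ideal (PIdl x) R" by (rule cgenideal_ideal[OF xc])
  have xsub: "\<not> PIdl x \<subseteq> M \<cdot> M" using cgenideal_self[OF xc] x(2) by blast
  have xM: "PIdl x \<subseteq> M" by (rule cgenideal_minimal[OF Mi x(1)])
  have MMx: "M \<cdot> M \<subseteq> PIdl x" using divided xi xsub by (auto simp: divided_ideal_def)
  have "PIdl x \<noteq> carrier R" using PIdl_ne_carrier x(1) by (simp add: M_nonunits)
  then have xOA: "OA_ideal (PIdl x) R" using OA_if_contains_square[OF xi _ MMx] by blast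
  have pow: "ideal_power R M (Suc (Suc k)) = ideal_power R M (Suc k) \<cdot> (PIdl x)" for k
  proof -
    note Pi = ideal_power_ideal[OF Mi, of k]
    have "ideal_power R M (Suc (Suc k)) = (ideal_power R M k \<cdot> M) \<cdot> M" by (simp add: ideal_power_Suc)
    also have "\<dots> = ideal_power R M k \<cdot> (M \<cdot> M)" by (rule ideal_prod_assoc[OF Pi Mi Mi])
    also have "\<dots> = ideal_power R M k \<cdot> (M \<cdot> (PIdl x))" using square_generated[OF MMx x] by simp
    also have "\<dots> = (ideal_power R M k \<cdot> M) \<cdot> (PIdl x)" by (rule ideal_prod_assoc[OF Pi Mi xi, symmetric])
    finally show ?thesis by (simp add: ideal_power_Suc)
  qed
  \<comment> \<open>The element \<open>x\<close> may be a zero divisor, so the colon ideal alone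
    could leave the power of \<open>M\<close>; the intersection keeps the order of \<open>J\<close>
    under control.\<close>
  define J where "J = {z \<in> carrier R. \<forall>b\<in>{x}. z \<otimes> b \<in> I} \<inter> ideal_power R M (Suc n)"
  note Pi = ideal_power_ideal[OF Mi, of "Suc n"]
  have "ideal {z \<in> carrier R. \<forall>b\<in>{x}. z \<otimes> b \<in> I} R"
    by (rule ideal_colon[OF Suc.prems(1)]) (use xc in simp)
  then have Ji: "ideal J R" unfolding J_def using Pi by (rule i_intersect)
  have IJ: "I = J \<cdot> (PIdl x)"
  proof
    show "J \<cdot> (PIdl x) \<subseteq> I"
    proof
      fix z assume "z \<in> J \<cdot> (PIdl x)"
      then obtain a where "a \<in> J" "z = a \<otimes> x" using prod_PIdl_iff[OF Ji xc] by blast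
      then show "z \<in> I" by (simp add: J_def)
    qed
    show "I \<subseteq> J \<cdot> (PIdl x)"
    proof
      fix z assume z: "z \<in> I"
      then have "z \<in> ideal_power R M (Suc n) \<cdot> (PIdl x)" using Suc.prems(2) pow by blast
      then obtain a where a: "a \<in> ideal_power R M (Suc n)" "z = a \<otimes> x"
        using prod_PIdl_iff[OF Pi xc] by blast
      then have "a \<in> J" using z ideal_carr[OF Pi a(1)] by (simp add: J_def)
      then show "z \<in> J \<cdot> (PIdl x)" using a(2) prod_PIdl_iff[OF Ji xc] by blast
    qed
  qed
  have "\<not> J \<subseteq> ideal_power R M (Suc (Suc n))"
  proof
    assume "J \<subseteq> ideal_power R M (Suc (Suc n))"
    then have "I \<subseteq> ideal_power R M (Suc (Suc n)) \<cdot> (PIdl x)"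
      unfolding IJ by (rule ideal_prod_mono) simp
    then show False using Suc.prems(3) pow[of "Suc n"] by simp
  qed
  moreover have "J \<subseteq> ideal_power R M (Suc n)" by (simp add: J_def)
  ultimately have "has_OA_factorization J R" using Suc.hyps[OF Ji] by blast
  then obtain Js where Js: "Js \<noteq> []" "\<forall>J\<in>set Js. OA_ideal J R" "J = ideal_list_prod R Js"
    by (auto simp: has_OA_factorization_def)
  have "I = ideal_list_prod R (PIdl x # Js)"
    using IJ Js(3) ideal_prod_commute[OF Ji xi] by simp
  then show ?case
    unfolding has_OA_factorization_def using Js xOA by (intro exI[of _ "PIdl x # Js"]) simp
qed

text \<open>Separation gives every nonzero proper ideal a finite order, so it can be factored by the
  preceding lemma. The zero ideal lies in all powers, hence its separate hypothesis
  \<open>zero\<close>.\<close>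

lemma divided_square_OAF:
  assumes divided: "divided_ideal (M \<cdot> M) R"
    and sep: "(\<Inter>n\<in>{1..}. ideal_power R M n) = {\<zero>}"
    and zero: "has_OA_factorization {\<zero>} R"
  shows "OAF_ring R"
  unfolding OAF_ring_def
proof (intro conjI allI impI)
  fix I assume "proper_ideal I R"
  then have I: "ideal I R" "I \<noteq> carrier R" by (simp_all add: proper_ideal_def)
  have IM: "I \<subseteq> M" by (rule proper_subset_M[OF I])
  show "has_OA_factorization I R"
  proof (cases "I = {\<zero>}")
    case False
    then obtain a where a: "a \<in> I" "a \<noteq> \<zero>" using ideal_zero[OF I(1)] by blast
    then have "\<exists>n\<ge>1. a \<notin> ideal_power R M n" using sep by auto
    then obtain n0 where n0: "n0 \<ge> 1" "\<not> I \<subseteq> ideal_power R M n0" using a by blast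
    define n where "n = (LEAST n. \<not> I \<subseteq> ideal_power R M (Suc n))"
    have "\<exists>n. \<not> I \<subseteq> ideal_power R M (Suc n)" using n0 by (metis Suc_le_D One_nat_def)
    then have n: "\<not> I \<subseteq> ideal_power R M (Suc n)" unfolding n_def by (rule LeastI_ex)
    have "n \<noteq> 0" using n IM ideal_power_1[OF M_ideal] by metis
    then obtain k where k: "n = Suc k" using not0_implies_Suc by blast
    then have Ik: "I \<subseteq> ideal_power R M (Suc k)"
      unfolding n_def using not_less_Least[of k "\<lambda>n. \<not> I \<subseteq> ideal_power R M (Suc n)"] by (metis lessI)
    \<comment> \<open>If M^2 = \<open>M\<close>, all positive powers would equal \<open>M\<close>,
      contrary to the choice of \<open>n\<close>.\<close>
    have "\<not> M \<subseteq> M \<cdot> M"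
    proof
      assume "M \<subseteq> M \<cdot> M"
      then have MM: "M \<cdot> M = M" using ideal_prod_subset_left[OF M_ideal M_ideal] by blast
      have "ideal_power R M (Suc j) = M" for j
        by (induct j) (simp_all add: carrier_prod_ideal[OF M_ideal] MM)
      then show False using n IM by simp
    qed
    then obtain x where "x \<in> M" "x \<notin> M \<cdot> M" by blast
    then show ?thesis using divided_square_factorization[OF divided _ _ I(1) Ik] n k by simp
  qed (use zero in simp)
qed (rule is_cring)

end

section \<open>Local rings satisfying the dimension and principal factorization hypotheses\<close>

locale OA_local = OA_principal + local_cring
begin

text \<open>Suppose M^2 = \<open>M\<close> and take \<open>u\<close> in \<open>M\<close> outside the
  nonmaximal primes. A factor of (u) contains M^2, so it equals \<open>M\<close>, and idempotence
  gives (u) = \<open>M\<close> (u). Nakayama yields \<open>u = \<zero>\<close>, an element of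
  \<open>P\<close>.\<close>

lemma maximal_not_square:
  assumes "P \<in> nonmax_primes"
  obtains w where "w \<in> M" "w \<notin> M \<cdot> M"
proof (rule ccontr)
  assume "\<not> thesis"
  note Mi = M_ideal
  have "M \<subseteq> M \<cdot> M" using that \<open>\<not> thesis\<close> by blast
  then have MM: "M \<cdot> M = M" using ideal_prod_subset_left[OF Mi Mi] by blast
  obtain u where u: "u \<in> M" "\<And>P. P \<in> nonmax_primes \<Longrightarrow> \<zero> \<oplus> u \<notin> P"
    using avoid_nonmax_primes[OF Mi maximal_not_below_nonmax_prime[OF M_maximal] zero_closed] by blast
  have uc: "u \<in> carrier R" using ideal_carr[OF Mi u(1)] .
  obtain Js where Js: "Js \<noteq> []" "\<forall>J\<in>set Js. OA_ideal J R" "PIdl u = ideal_list_prod R Js"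
    using principal_factorization[of u] u(1) by (auto simp: has_OA_factorization_def M_nonunits)
  obtain J Ks where JK: "Js = J # Ks" using Js(1) by (cases Js) auto
  have id: "ideal J R" if "J \<in> set Js" for J using Js(2) OA_ideal_proper(1) that by blast
  have "u \<in> J" using ideal_list_prod_subset[of Js J] id JK Js(3) cgenideal_self[OF uc] by auto
  have "J \<notin> nonmax_primes" using u \<open>u \<in> J\<close> uc by auto
  have "M \<cdot> M \<subseteq> J"
    using OA_square_cases[of J] Js(2) JK prime_maximal_or_nonmax[of J] \<open>J \<notin> nonmax_primes\<close>
      maximal_eq_nonunits[of J] Mi MM by (auto simp: M_nonunits)
  moreover have "J \<subseteq> M" using OA_ideal_proper(3)[of J] Js(2) JK by (simp add: M_nonunits)
  ultimately have "J = M" using MM by simp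
  have Ki: "ideal (ideal_list_prod R Ks) R" by (rule ideal_list_prod_ideal) (use id JK in simp)
  have "PIdl u = M \<cdot> ideal_list_prod R Ks" using Js(3) JK \<open>J = M\<close> by simp
  also have "\<dots> = M \<cdot> (PIdl u)"
    using ideal_prod_assoc[OF Mi Mi Ki] MM Js(3) JK \<open>J = M\<close> by simp
  finally have "u = \<zero>" using nakayama[OF uc] cgenideal_self[OF uc] by simp
  moreover have "\<zero> \<in> P" using ideal_zero[OF prime_ideal_props(1)[OF nonmax_primesD[OF assms]]] .
  ultimately show False using u(2)[OF assms] by simp
qed

lemma OA_contains_square:
  assumes "OA_ideal J R" "J \<notin> nonmax_primes"
  shows "M \<cdot> M \<subseteq> J"
proof (cases "primeideal J R")
  case True
  then have "J = M"
    using prime_maximal_or_nonmax[OF _ assms(2)] maximal_eq_nonunits M_ideal by (simp add: M_nonunits)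
  then show ?thesis using ideal_prod_subset_left[OF M_ideal M_ideal] by simp
qed (use OA_square_cases[OF assms(1)] in blast)

lemma avoiding_factorization:
  assumes "z \<in> M" "\<And>P. P \<in> nonmax_primes \<Longrightarrow> z \<notin> P"
  obtains Js where "Js \<noteq> []" "\<And>J. J \<in> set Js \<Longrightarrow> ideal J R \<and> J \<subseteq> M \<and> M \<cdot> M \<subseteq> J"
    "PIdl z = ideal_list_prod R Js"
proof -
  have zc: "z \<in> carrier R" using ideal_carr[OF M_ideal assms(1)] .
  obtain Js where Js: "Js \<noteq> []" "\<forall>J\<in>set Js. OA_ideal J R" "PIdl z = ideal_list_prod R Js"
    using principal_factorization[of z] assms(1) by (auto simp: has_OA_factorization_def M_nonunits)
  have id: "ideal J R" if "J \<in> set Js" for J using Js(2) OA_ideal_proper(1) that by blast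
  have "ideal J R \<and> J \<subseteq> M \<and> M \<cdot> M \<subseteq> J" if J: "J \<in> set Js" for J
  proof -
    have OA: "OA_ideal J R" using Js(2) J by blast
    have "z \<in> J" using ideal_list_prod_subset[of Js J, OF id J] Js(3) cgenideal_self[OF zc] by blast
    then have "J \<notin> nonmax_primes" using assms(2) by blast
    then show ?thesis
      using OA_contains_square[OF OA] id[OF J] OA_ideal_proper(3)[OF OA] by (simp add: M_nonunits)
  qed
  then show ?thesis using that Js by blast
qed

text \<open>Two or more factors of (z) would place \<open>z\<close> in M^2. So (z) is a single
  factor, and that factor contains M^2.\<close>

lemma square_below_principal:
  assumes "z \<in> M" "z \<notin> M \<cdot> M" "\<And>P. P \<in> nonmax_primes \<Longrightarrow> z \<notin> P"
  shows "M \<cdot> M \<subseteq> PIdl z"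
proof -
  obtain Js where Js: "Js \<noteq> []" "\<And>J. J \<in> set Js \<Longrightarrow> ideal J R \<and> J \<subseteq> M \<and> M \<cdot> M \<subseteq> J"
    "PIdl z = ideal_list_prod R Js"
    using avoiding_factorization[OF assms(1,3)] by metis
  obtain J Ks where JK: "Js = J # Ks" using Js(1) by (cases Js) auto
  show ?thesis
  proof (cases Ks)
    case Nil
    then show ?thesis using Js JK ideal_list_prod_single[of J] by simp
  next
    case (Cons L Ls)
    have "ideal_list_prod R Ks \<subseteq> L" using ideal_list_prod_subset[of Ks L] Js(2) JK Cons by simp
    then have "ideal_list_prod R Ks \<subseteq> M" using Js(2)[of L] JK Cons by auto
    moreover have "J \<subseteq> M" using Js(2)[of J] JK by simp
    ultimately have "PIdl z \<subseteq> M \<cdot> M"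
      unfolding Js(3) JK ideal_list_prod_Cons by (intro ideal_prod_mono)
    then show ?thesis using assms(2) cgenideal_self[OF ideal_carr[OF M_ideal assms(1)]] by blast
  qed
qed

text \<open>For \<open>x\<close> in \<open>P\<close> outside M^2, choose \<open>u\<close> in M^2
  such that x + u avoids the nonmaximal primes. Then M^2 is below (x + u), so u = (x + u) s, that
  is, u (1 - s) = x s. Since \<open>u\<close> is not in \<open>P\<close>, 1 - s is in
  \<open>P\<close>, so \<open>s\<close> is a unit; but x s lies in M^2, and hence so does
  \<open>x\<close>.\<close>

lemma nonmax_prime_below_square:
  assumes P: "P \<in> nonmax_primes"
  shows "P \<subseteq> M \<cdot> M"
proof
  note Pp = nonmax_primesD[OF P]
  note Pi = prime_ideal_props(1)[OF Pp]
  note MMi = ideal_prod_is_ideal[OF M_ideal M_ideal]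
  fix x assume x: "x \<in> P"
  have xc: "x \<in> carrier R" using ideal_carr[OF Pi x] .
  have PM: "P \<subseteq> M" by (rule proper_subset_M[OF prime_ideal_props(1,2)[OF Pp]])
  show "x \<in> M \<cdot> M"
  proof (rule ccontr)
    assume nx: "x \<notin> M \<cdot> M"
    obtain u where u: "u \<in> M \<cdot> M" "\<And>P. P \<in> nonmax_primes \<Longrightarrow> x \<oplus> u \<notin> P"
      using avoid_nonmax_primes[OF MMi square_not_below_nonmax_prime[OF M_maximal] xc] by blast
    have uc: "u \<in> carrier R" using ideal_carr[OF MMi u(1)] .
    have uP: "u \<notin> P" using u(2)[OF P] ideal_add[OF Pi x] by blast
    have zM: "x \<oplus> u \<in> M" using ideal_add[OF M_ideal] x PM u(1) ideal_prod_subset_left[OF M_ideal M_ideal] by blast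
    have "x \<oplus> u \<notin> M \<cdot> M" using ideal_add_cancel_right[OF MMi u(1) xc] nx by simp
    then have "u \<in> PIdl (x \<oplus> u)" using square_below_principal[OF zM _ u(2)] u(1) by blast
    then obtain s where s: "s \<in> carrier R" "u = (x \<oplus> u) \<otimes> s" using PIdl_iff xc uc by auto
    have "u \<otimes> (\<one> \<ominus> s) = u \<ominus> u \<otimes> s" using uc s(1) by algebra
    also have "\<dots> = (x \<oplus> u) \<otimes> s \<ominus> u \<otimes> s" using s(2) by simp
    also have "\<dots> = x \<otimes> s" using xc uc s(1) by algebra
    finally have eq: "u \<otimes> (\<one> \<ominus> s) = x \<otimes> s" .
    then have "u \<otimes> (\<one> \<ominus> s) \<in> P" using ideal_mult_right[OF Pi x s(1)] by simp
    then have 1: "\<one> \<ominus> s \<in> P" using prime_ideal_props(4)[OF Pp uc] uP s(1) by simp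
    have "s \<in> Units R"
    proof (rule ccontr)
      assume "s \<notin> Units R"
      then have "s \<in> M" using unit_iff s(1) by simp
      moreover have "\<one> \<ominus> s \<in> M" using 1 PM by blast
      ultimately have "\<one> \<in> M" using ideal_minusD[OF M_ideal] by simp
      then show False using prime_ideal_props(3)[OF maximal_ideal_props(1)[OF M_maximal]] by simp
    qed
    moreover have "s \<otimes> x \<in> M \<cdot> M"
    proof -
      have "u \<otimes> (\<one> \<ominus> s) \<in> M \<cdot> M" using ideal_mult_right[OF MMi u(1)] s(1) by simp
      then show ?thesis using eq xc s(1) by (simp add: m_comm)
    qed
    ultimately show False using ideal_cancel_unit[OF MMi _ xc] nx by blast
  qed
qed

text \<open>Some \<open>y\<close> in \<open>M\<close> outside \<open>P\<close> satisfies that (y)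
  contains M^2 and hence \<open>P\<close>, so P = y P and P = M P. As \<open>P\<close> divides each
  (x) with \<open>x\<close> in \<open>P\<close>, also (x) = \<open>M\<close> (x), and Nakayama
  finishes.\<close>

lemma nonmax_prime_zero:
  assumes P: "P \<in> nonmax_primes"
  shows "P = {\<zero>}"
proof -
  note Pp = nonmax_primesD[OF P]
  note Pi = prime_ideal_props(1)[OF Pp]
  note MMi = ideal_prod_is_ideal[OF M_ideal M_ideal]
  obtain w where w: "w \<in> M" "w \<notin> M \<cdot> M" using maximal_not_square[OF P] by blast
  have wc: "w \<in> carrier R" using ideal_carr[OF M_ideal w(1)] .
  obtain u where u: "u \<in> M \<cdot> M" "\<And>P. P \<in> nonmax_primes \<Longrightarrow> w \<oplus> u \<notin> P"
    using avoid_nonmax_primes[OF MMi square_not_below_nonmax_prime[OF M_maximal] wc] by blast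
  define y where "y = w \<oplus> u"
  have yM: "y \<in> M"
    unfolding y_def using ideal_add[OF M_ideal w(1)] u(1) ideal_prod_subset_left[OF M_ideal M_ideal] by blast
  have yc: "y \<in> carrier R" using ideal_carr[OF M_ideal yM] .
  have yMM: "y \<notin> M \<cdot> M" unfolding y_def using ideal_add_cancel_right[OF MMi u(1) wc] w(2) by simp
  have "M \<cdot> M \<subseteq> PIdl y" using square_below_principal[OF yM yMM] u(2) y_def by blast
  then have Py: "P \<subseteq> PIdl y" using nonmax_prime_below_square[OF P] by blast
  have PMP: "P = M \<cdot> P"
  proof
    show "M \<cdot> P \<subseteq> P" by (rule ideal_prod_subset_right[OF M_ideal Pi])
    show "P \<subseteq> M \<cdot> P"
    proof
      fix p assume p: "p \<in> P"
      then obtain r where r: "r \<in> carrier R" "p = y \<otimes> r" using Py PIdl_iff[OF yc] by blast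
      then have "r \<in> P" using prime_ideal_props(4)[OF Pp yc r(1)] p u(2)[OF P] by (simp add: y_def)
      then show "p \<in> M \<cdot> P" unfolding r(2) using yM by (rule ideal_prod.prod[rotated])
    qed
  qed
  have "x = \<zero>" if x: "x \<in> P" for x
  proof -
    have xc: "x \<in> carrier R" using ideal_carr[OF Pi x] .
    obtain K where K: "ideal K R" "PIdl x = P \<cdot> K" using nonmax_prime_divides[OF P x] by blast
    have "M \<cdot> (PIdl x) = (M \<cdot> P) \<cdot> K" unfolding K(2) by (rule ideal_prod_assoc[OF M_ideal Pi K(1), symmetric])
    then have "M \<cdot> (PIdl x) = PIdl x" using PMP K(2) by simp
    then show ?thesis using nakayama[OF xc] cgenideal_self[OF xc] by simp
  qed
  then show ?thesis using ideal_zero[OF Pi] by blast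
qed

text \<open>An element of \<open>J\<close> outside M^2 avoids all nonmaximal primes, since these lie
  in M^2; its principal ideal therefore contains M^2.\<close>

lemma square_divided: "divided_ideal (M \<cdot> M) R"
  unfolding divided_ideal_def
proof (intro conjI allI impI)
  show "ideal (M \<cdot> M) R" by (rule ideal_prod_is_ideal[OF M_ideal M_ideal])
  fix J assume J: "ideal J R"
  show "M \<cdot> M \<subseteq> J \<or> J \<subseteq> M \<cdot> M"
  proof (cases "J = carrier R")
    case True
    then show ?thesis using ideal_subset_carrier ideal_prod_is_ideal[OF M_ideal M_ideal] by blast
  next
    case False
    have "M \<cdot> M \<subseteq> J" if "\<not> J \<subseteq> M \<cdot> M"
    proof -
      obtain z where z: "z \<in> J" "z \<notin> M \<cdot> M" using \<open>\<not> J \<subseteq> M \<cdot> M\<close> by blast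
      have zM: "z \<in> M" using proper_subset_M[OF J False] z(1) by blast
      have "z \<notin> P" if "P \<in> nonmax_primes" for P
        using nonmax_prime_below_square[OF that] z(2) by blast
      then have "M \<cdot> M \<subseteq> PIdl z" using square_below_principal[OF zM z(2)] by blast
      also have "\<dots> \<subseteq> J" by (rule cgenideal_minimal[OF J z(1)])
      finally show ?thesis .
    qed
    then show ?thesis by blast
  qed
qed

text \<open>Without nonmaximal primes, all factors of the zero ideal contain M^2, so a power of
  \<open>M\<close> vanishes. Otherwise the zero ideal is prime. A nonzero \<open>z\<close> in all
  powers would have (z) containing some power of \<open>M\<close>, so the next power, and with it
  \<open>z\<close>, would lie in \<open>M\<close> (z), against Nakayama.\<close>

lemma nilpotent_or_domain:
  "nilpotent_ideal M R \<or> domain R \<and> (\<Inter>n\<in>{1..}. ideal_power R M n) = {\<zero>}"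
proof (cases "nonmax_primes = {}")
  case True
  have "\<zero> \<in> M" by (rule ideal_zero[OF M_ideal])
  then obtain Js where Js: "Js \<noteq> []" "\<And>J. J \<in> set Js \<Longrightarrow> ideal J R \<and> J \<subseteq> M \<and> M \<cdot> M \<subseteq> J"
    "PIdl \<zero> = ideal_list_prod R Js"
    using avoiding_factorization[of \<zero>] True by (metis empty_iff)
  have "ideal_power R M (2 * length Js) \<subseteq> {\<zero>}"
    using power_subset_list_prod[of Js] Js(2) unfolding Js(3)[symmetric] PIdl_zero by blast
  then have "ideal_power R M (2 * length Js) = {\<zero>}"
    using ideal_zero[OF ideal_power_ideal[OF M_ideal]] by blast
  moreover have "2 * length Js \<ge> 1" using Js(1) by (cases Js) auto
  ultimately show ?thesis unfolding nilpotent_ideal_def using M_ideal by blast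
next
  case False
  then obtain P where P: "P \<in> nonmax_primes" by blast
  have "primeideal {\<zero>} R" using nonmax_primesD[OF P] nonmax_prime_zero[OF P] by simp
  then have dom: "domain R" by (rule zeroprimeideal_domainI)
  have "z = \<zero>" if z: "z \<in> (\<Inter>n\<in>{1..}. ideal_power R M n)" for z
  proof (rule ccontr)
    assume nz: "z \<noteq> \<zero>"
    have zpow: "z \<in> ideal_power R M (Suc n)" for n using INT_D[OF z, of "Suc n"] by simp
    have zM: "z \<in> M" using zpow[of 0] carrier_prod_ideal[OF M_ideal] by simp
    have zc: "z \<in> carrier R" using ideal_carr[OF M_ideal zM] .
    have "z \<notin> P" if "P \<in> nonmax_primes" for P using nonmax_prime_zero[OF that] nz by simp
    then obtain Js where Js: "Js \<noteq> []" "\<And>J. J \<in> set Js \<Longrightarrow> ideal J R \<and> J \<subseteq> M \<and> M \<cdot> M \<subseteq> J"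
      "PIdl z = ideal_list_prod R Js"
      using avoiding_factorization[OF zM] by metis
    let ?n = "2 * length Js"
    have "ideal_power R M ?n \<subseteq> PIdl z" using power_subset_list_prod[of Js] Js(2,3) by simp
    then have "ideal_power R M ?n \<cdot> M \<subseteq> (PIdl z) \<cdot> M" by (rule ideal_prod_mono) simp
    then have "z \<in> (PIdl z) \<cdot> M" using zpow[of ?n] by (auto simp: ideal_power_Suc)
    then have "z \<in> M \<cdot> (PIdl z)" using ideal_prod_commute[OF M_ideal cgenideal_ideal[OF zc]] by simp
    then show False using nakayama[OF zc] nz by blast
  qed
  moreover have "\<zero> \<in> (\<Inter>n\<in>{1..}. ideal_power R M n)" using ideal_zero[OF ideal_power_ideal[OF M_ideal]] by simp
  ultimately show ?thesis using dom by blast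
qed

end

section \<open>The equivalence of the four conditions\<close>

theorem theorem4p2:
  fixes R :: "('a, 'b) ring_scheme" and M :: "'a set"
  assumes "cring R"
    and "\<one>\<^bsub>R\<^esub> \<noteq> \<zero>\<^bsub>R\<^esub>"
    and "M = jacobson_radical R"
  defines "S1 \<equiv> OAF_ring R"
    and "S2 \<equiv> (\<forall>I. proper_ideal I R \<and> two_generated I R \<longrightarrow> has_OA_factorization I R)"
    and "S3 \<equiv> krull_dim R \<le> 1 \<and>
               (\<forall>I. proper_ideal I R \<and> principalideal I R \<longrightarrow> has_OA_factorization I R)"
    and "S4 \<equiv> general_ZPI_ring R \<or>
               (local_ring R \<and> domain R \<and> divided_ideal (ideal_power R M 2) R \<and>
                  (\<Inter>n \<in> {1..}. ideal_power R M n) = {\<zero>\<^bsub>R\<^esub>}) \<or>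
               (local_ring R \<and> divided_ideal (ideal_power R M 2) R \<and> nilpotent_ideal M R)"
  shows "(S1 \<longleftrightarrow> S2) \<and> (S2 \<longleftrightarrow> S3) \<and> (S3 \<longleftrightarrow> S4)"
proof -
  interpret cring R by fact
  have S12: S2 if S1 using that by (simp add: S1_def S2_def OAF_ring_def)
  have S23: S3 if S2
  proof -
    have H: "\<And>I. \<lbrakk>proper_ideal I R; two_generated I R\<rbrakk> \<Longrightarrow> has_OA_factorization I R"
      using \<open>S2\<close> by (simp add: S2_def)
    have "two_generated I R" if "principalideal I R" for I
    proof -
      obtain i where i: "i \<in> carrier R" "I = genideal R {i}"
        using principalideal.generate[OF \<open>principalideal I R\<close>] by blast
      then show ?thesis using PIdl_two_generated[OF i(1)] cgenideal_eq_genideal[OF i(1)] by simp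
    qed
    then show S3
      unfolding S3_def using H two_generated_factorizations_imp_dim_le_one[OF H] by blast
  qed
  have S34: S4 if S3
  proof -
    have op: "OA_principal R"
    proof (intro OA_principal.intro OA_principal_axioms.intro is_cring)
      show "\<one>\<^bsub>R\<^esub> \<noteq> \<zero>\<^bsub>R\<^esub>" by fact
      show "krull_dim R \<le> 1" using \<open>S3\<close> by (simp add: S3_def)
      show "has_OA_factorization (PIdl\<^bsub>R\<^esub> x) R" if "x \<in> nonunits R" for x
        using \<open>S3\<close> PIdl_proper[OF that] cgenideal_is_principalideal[of x] that
        by (simp add: S3_def nonunits_def)
    qed
    show S4
    \<comment> \<open>The first case leads to (A). In the second, a nonprime 1-absorbing ideal makes
      the ring local and leads to (B) or (C).\<close>
    proof (cases "\<forall>J. OA_ideal J R \<longrightarrow> primeideal J R")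
      case True
      then have "prime_principal R" by (intro prime_principal.intro prime_principal_axioms.intro op) blast
      then have "general_ZPI_ring R" by (rule prime_principal.general_ZPI)
      then show ?thesis unfolding S4_def by (rule disjI1)
    next
      case False
      then obtain J where "OA_ideal J R" "\<not> primeideal J R" by blast
      then have nu: "ideal (nonunits R) R" by (rule nonprime_OA_imp_local)
      have M: "M = nonunits R" using assms(3) jacobson_radical_local[OF nu] by simp
      have Mi: "ideal M R" using nu M by simp
      have loc: "OA_local R M"
        by (intro OA_local.intro op local_cring.intro local_cring_axioms.intro is_cring M Mi)
      have "local_ring R" using local_ring_iff nu by simp
      moreover have "divided_ideal (ideal_power R M 2) R"
        using OA_local.square_divided[OF loc] ideal_power_2[OF Mi] by simp
      ultimately show ?thesis using OA_local.nilpotent_or_domain[OF loc] unfolding S4_def by blast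
    qed
  qed
  have S41: S1 if S4
  proof -
    \<comment> \<open>Cases (B) and (C) share this argument and differ in how the zero ideal is
      factored: it is prime in a domain, and a power of \<open>M\<close> when \<open>M\<close> is
      nilpotent.\<close>
    have local_case: S1
      if loc: "local_ring R" and div: "divided_ideal (ideal_power R M 2) R"
        and sep: "(\<Inter>n\<in>{1..}. ideal_power R M n) = {\<zero>\<^bsub>R\<^esub>}"
        and zero: "ideal M R \<Longrightarrow> M = nonunits R \<Longrightarrow> has_OA_factorization {\<zero>\<^bsub>R\<^esub>} R"
    proof -
      have nu: "ideal (nonunits R) R" using loc local_ring_iff by simp
      have M: "M = nonunits R" using assms(3) jacobson_radical_local[OF nu] by simp
      have Mi: "ideal M R" using nu M by simp
      have lc: "local_cring R M" by (intro local_cring.intro local_cring_axioms.intro is_cring M Mi)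
      have "divided_ideal (M \<cdot>\<^bsub>R\<^esub> M) R" using div ideal_power_2[OF Mi] by simp
      then show S1
        unfolding S1_def by (rule local_cring.divided_square_OAF[OF lc _ sep zero[OF Mi M]])
    qed
    consider "general_ZPI_ring R"
      | "local_ring R" "domain R" "divided_ideal (ideal_power R M 2) R"
        "(\<Inter>n \<in> {1..}. ideal_power R M n) = {\<zero>\<^bsub>R\<^esub>}"
      | "local_ring R" "divided_ideal (ideal_power R M 2) R" "nilpotent_ideal M R"
      using \<open>S4\<close> unfolding S4_def by blast
    then show S1
    proof cases
      case 1
      then show ?thesis
        unfolding S1_def general_ZPI_ring_def OAF_ring_def has_OA_factorization_def
        using prime_imp_OA by meson
    next
      case 2
      have p: "primeideal {\<zero>\<^bsub>R\<^esub>} R" by (rule domain.zeroprimeideal[OF 2(2)])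
      have "has_OA_factorization {\<zero>\<^bsub>R\<^esub>} R"
        unfolding has_OA_factorization_def
        using prime_imp_OA[OF p] ideal_list_prod_single[OF zeroideal] by (intro exI[of _ "[{\<zero>\<^bsub>R\<^esub>}]"]) simp
      then show ?thesis using local_case 2 by blast
    next
      case 3
      then obtain n where n: "n \<ge> 1" "ideal_power R M n = {\<zero>\<^bsub>R\<^esub>}" "ideal M R"
        by (auto simp: nilpotent_ideal_def)
      \<comment> \<open>The vanishing power is itself a member of the intersection because its
        exponent is positive.\<close>
      have "(\<Inter>n\<in>{1..}. ideal_power R M n) = {\<zero>\<^bsub>R\<^esub>}"
        using n ideal_zero[OF ideal_power_ideal[OF n(3)]] by auto
      moreover have "has_OA_factorization {\<zero>\<^bsub>R\<^esub>} R" if M: "M = nonunits R"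
      proof -
        have "ideal_power R M k = ideal_list_prod R (replicate k M)" for k
        proof (induct k)
          case (Suc k)
          then show ?case
            using ideal_prod_commute[OF ideal_power_ideal[OF n(3), of k] n(3)] by (simp add: ideal_power_Suc)
        qed (simp add: carrier_prod_ideal)
        moreover have "maximalideal M R" using maximal_eq_nonunits n(3) M by simp
        then have "OA_ideal M R" using prime_imp_OA maximal_ideal_props(1) by blast
        ultimately show ?thesis
          unfolding has_OA_factorization_def using n(1,2) by (intro exI[of _ "replicate n M"]) auto
      qed
      ultimately show ?thesis using local_case 3 by blast
    qed
  qed
  show ?thesis using S12 S23 S34 S41 by blast
qed

end
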